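(* Let $\Omega=(0,1)^d$, let $s\ge1$, let $\varphi(x)=(1+\mathrm{ReLU}(x))^s$ and $\sigma(x)=\exp(i2\pi x)$. Then $B_{\exp(i2\pi x)}^{(1+\mathrm{ReLU}(x))^s}=\mathscr{B}^s$ as sets of functions on $\Omega$, and the norms $\|\cdot\|_{B_{\exp(i2\pi x)}^{(1+\mathrm{ReLU}(x))^s}}$ and $\|\cdot\|_{\mathscr{B}^s}$ are equivalent.
   Context: $\mathrm{ReLU}(x)=\max(0,x)$. Functions on $\Omega$ are identified when they agree almost everywhere. The Fourier transform convention is $\hat f(\xi)=\int_{\mathbb{R}^d}f(x)e^{-i2\pi\xi\cdot x}\,\mathrm{d}x$ (extended to tempered distributions). Spectral Barron space $\mathscr{B}^s$: the set of $f\in C_b(\Omega)$ (bounded continuous functions) that admit a bounded continuous extension $f_e$ to $\mathbb{R}^d$, $f_e|_\Omega=f$, with $(1+|\xi|)^s\hat f_e\in L^1(\mathbb{R}^d)$; $\|f\|_{\mathscr{B}^s}=\inf_{f_e|_\Omega=f}\int_{\mathbb{R}^d}(1+|\xi|)^s|\hat f_e(\xi)|\,\mathrm{d}\xi$, the infimum being over all such extensions. Generalized Barron space $B_\sigma^\varphi=B_\sigma^\varphi(\Omega)$: the set of measurable $f:\Omega\to\mathbb{C}$ for which there is a finite complex Radon measure $\rho$ on $\mathbb{R}^{d+1}$ (points $(w,b)$, $w\in\mathbb{R}^d$, $b\in\mathbb{R}$) with $f(x)=\int_{\mathbb{R}^{d+1}}\sigma(w\cdot x+b)\,\mathrm{d}\rho(w,b)$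 for a.e. $x\in\Omega$ and $\int_{\mathbb{R}^{d+1}}\varphi(\|w\|_1+|b|)\,\mathrm{d}|\rho|<\infty$; $\|f\|_{B_\sigma^\varphi}$ is the infimum of the latter integral over all such $\rho$ ($|\rho|$ is the total variation). *)

theory Defs
  imports "HOL-Analysis.Analysis"
begin

section \<open>Complex measures\<close>

text \<open>A complex measure is a countably additive complex set function on the sigma-algebra of \<open>M\<close>
  (only the sigma-algebra of \<open>M\<close> is used; values of \<open>\<rho>\<close> on other sets are irrelevant).
  Taking the constant sequence of empty sets yields \<open>\<rho> {} = 0\<close>.\<close>

definition complex_measure :: "'a measure \<Rightarrow> ('a set \<Rightarrow> complex) \<Rightarrow> bool" where
  "complex_measure M \<rho> \<longleftrightarrow>
     (\<forall>A::nat \<Rightarrow> 'a set. range A \<subseteq> sets M \<longrightarrow> disjoint_family A \<longrightarrow>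
        (\<lambda>i. \<rho> (A i)) sums \<rho> (\<Union>i. A i))"

definition total_variation :: "'a measure \<Rightarrow> ('a set \<Rightarrow> complex) \<Rightarrow> 'a measure" where
  "total_variation M \<rho> = measure_of (space M) (sets M)
     (\<lambda>A. SUP E\<in>{E::nat \<Rightarrow> 'a set. range E \<subseteq> sets M \<and> disjoint_family E \<and> (\<Union>i. E i) = A}.
            \<Sum>i. ennreal (cmod (\<rho> (E i))))"

text \<open>The positive part of the Jordan decomposition of a real signed measure \<open>\<nu>\<close>; the negative part
  is the positive part of \<open>- \<nu>\<close>. The coercion \<^const>\<open>ennreal\<close> sends negative values to 0, which
  does not affect the supremum because \<open>\<nu> {} = 0\<close>.\<close>

definition positive_variation :: "'a measure \<Rightarrow> ('a set \<Rightarrow> real) \<Rightarrow> 'a measure" where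
  "positive_variation M \<nu> = measure_of (space M) (sets M)
     (\<lambda>A. SUP B\<in>{B \<in> sets M. B \<subseteq> A}. ennreal (\<nu> B))"

definition signed_integral :: "'a measure \<Rightarrow> ('a set \<Rightarrow> real) \<Rightarrow> ('a \<Rightarrow> complex) \<Rightarrow> complex" where
  "signed_integral M \<nu> f =
     integral\<^sup>L (positive_variation M \<nu>) f - integral\<^sup>L (positive_variation M (\<lambda>A. - \<nu> A)) f"

definition complex_integral :: "'a measure \<Rightarrow> ('a set \<Rightarrow> complex) \<Rightarrow> ('a \<Rightarrow> complex) \<Rightarrow> complex" where
  "complex_integral M \<rho> f =
     signed_integral M (\<lambda>A. Re (\<rho> A)) f + \<i> * signed_integral M (\<lambda>A. Im (\<rho> A)) f"

definition finite_complex_radon_measure :: "('a::euclidean_space set \<Rightarrow> complex) \<Rightarrow> bool" where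
  "finite_complex_radon_measure \<rho> \<longleftrightarrow>
     complex_measure borel \<rho> \<and>
     emeasure (total_variation borel \<rho>) UNIV < \<infinity> \<and>
     (\<forall>A\<in>sets borel. emeasure (total_variation borel \<rho>) A =
        (SUP K\<in>{K. compact K \<and> K \<subseteq> A}. emeasure (total_variation borel \<rho>) K))"


section \<open>The generalized Barron space\<close>

definition ReLU :: "real \<Rightarrow> real" where
  "ReLU x = max 0 x"

definition l1_norm :: "real ^ 'd \<Rightarrow> real" where
  "l1_norm w = (\<Sum>i\<in>UNIV. \<bar>w $ i\<bar>)"

text \<open>Functions on \<open>\<Omega>\<close> are represented by total functions of which only the values on \<open>\<Omega>\<close> matter.
  Integrability of \<open>\<sigma>(w \<bullet> x + b)\<close> is stated explicitly, since the Bochner integral of a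
  non-integrable function is 0 by convention.\<close>

definition barron_representation ::
  "(real ^ 'd) set \<Rightarrow> (real \<Rightarrow> complex) \<Rightarrow> (real \<Rightarrow> real) \<Rightarrow> (real ^ 'd \<Rightarrow> complex) \<Rightarrow>
   (((real ^ 'd) \<times> real) set \<Rightarrow> complex) \<Rightarrow> bool" where
  "barron_representation \<Omega> \<sigma> \<phi> f \<rho> \<longleftrightarrow>
     finite_complex_radon_measure \<rho> \<and>
     (AE x in lebesgue_on \<Omega>.
        integrable (total_variation borel \<rho>) (\<lambda>(w, b). \<sigma> (w \<bullet> x + b)) \<and>
        f x = complex_integral borel \<rho> (\<lambda>(w, b). \<sigma> (w \<bullet> x + b))) \<and>
     integrable (total_variation borel \<rho>) (\<lambda>(w, b). \<phi> (l1_norm w + \<bar>b\<bar>))"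

definition barron_space ::
  "(real ^ 'd) set \<Rightarrow> (real \<Rightarrow> complex) \<Rightarrow> (real \<Rightarrow> real) \<Rightarrow> (real ^ 'd \<Rightarrow> complex) set" where
  "barron_space \<Omega> \<sigma> \<phi> =
     {f \<in> borel_measurable (lebesgue_on \<Omega>). \<exists>\<rho>. barron_representation \<Omega> \<sigma> \<phi> f \<rho>}"

definition barron_norm ::
  "(real ^ 'd) set \<Rightarrow> (real \<Rightarrow> complex) \<Rightarrow> (real \<Rightarrow> real) \<Rightarrow> (real ^ 'd \<Rightarrow> complex) \<Rightarrow> real" where
  "barron_norm \<Omega> \<sigma> \<phi> f =
     Inf {integral\<^sup>L (total_variation borel \<rho>) (\<lambda>(w, b). \<phi> (l1_norm w + \<bar>b\<bar>)) |\<rho>.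
            barron_representation \<Omega> \<sigma> \<phi> f \<rho>}"


section \<open>Fourier transform of tempered distributions\<close>

definition partial_deriv :: "'d \<Rightarrow> (real ^ 'd \<Rightarrow> complex) \<Rightarrow> real ^ 'd \<Rightarrow> complex" where
  "partial_deriv i f x = vector_derivative (\<lambda>t. f (x + t *\<^sub>R axis i 1)) (at 0)"

primrec iterated_partial :: "'d list \<Rightarrow> (real ^ 'd \<Rightarrow> complex) \<Rightarrow> real ^ 'd \<Rightarrow> complex" where
  "iterated_partial [] f = f"
| "iterated_partial (i # is) f = partial_deriv i (iterated_partial is f)"

text \<open>Derivatives of all orders are indexed by lists of coordinates rather than by multi-indices;
  smoothness says that every iterated partial derivative is (Frechet) differentiable.\<close>

definition schwartz_space :: "(real ^ 'd \<Rightarrow> complex) set" where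
  "schwartz_space =
     {\<psi>. (\<forall>is x. iterated_partial is \<psi> differentiable (at x)) \<and>
          (\<forall>is k. bounded (range (\<lambda>x. (1 + norm x) ^ k *\<^sub>R iterated_partial is \<psi> x)))}"

definition fourier :: "(real ^ 'd \<Rightarrow> complex) \<Rightarrow> real ^ 'd \<Rightarrow> complex" where
  "fourier \<psi> \<xi> = (LINT x|lborel. \<psi> x * exp (- \<i> * complex_of_real (2 * pi * (\<xi> \<bullet> x))))"

definition regular_distribution ::
  "(real ^ 'd \<Rightarrow> complex) \<Rightarrow> (real ^ 'd \<Rightarrow> complex) \<Rightarrow> complex" where
  "regular_distribution u \<psi> = (LINT x|lborel. u x * \<psi> x)"

definition distribution_fourier ::
  "((real ^ 'd \<Rightarrow> complex) \<Rightarrow> complex) \<Rightarrow> (real ^ 'd \<Rightarrow> complex) \<Rightarrow> complex" where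
  "distribution_fourier T \<psi> = T (fourier \<psi>)"

text \<open>The Fourier transform of the tempered distribution given by \<open>u\<close> is the function \<open>g\<close>.
  It is only used for bounded continuous \<open>u\<close> and for \<open>g\<close> integrable against a weight
  \<open>(1 + |\<xi>|)\<^sup>s\<close>, which both define tempered distributions.\<close>

definition has_fourier_transform ::
  "(real ^ 'd \<Rightarrow> complex) \<Rightarrow> (real ^ 'd \<Rightarrow> complex) \<Rightarrow> bool" where
  "has_fourier_transform u g \<longleftrightarrow>
     (\<forall>\<psi>\<in>schwartz_space.
        distribution_fourier (regular_distribution u) \<psi> = regular_distribution g \<psi>)"


section \<open>The spectral Barron space\<close>

text \<open>\<open>fe\<close> is a bounded continuous extension of \<open>f\<close> and \<open>g\<close> its Fourier transform; \<open>g\<close> is determined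
  by \<open>fe\<close> up to a null set.\<close>

definition spectral_extension ::
  "real \<Rightarrow> (real ^ 'd) set \<Rightarrow> (real ^ 'd \<Rightarrow> complex) \<Rightarrow> (real ^ 'd \<Rightarrow> complex) \<Rightarrow>
   (real ^ 'd \<Rightarrow> complex) \<Rightarrow> bool" where
  "spectral_extension s \<Omega> f fe g \<longleftrightarrow>
     continuous_on UNIV fe \<and> bounded (range fe) \<and> (\<forall>x\<in>\<Omega>. fe x = f x) \<and>
     has_fourier_transform fe g \<and>
     integrable lborel (\<lambda>\<xi>. (1 + norm \<xi>) powr s *\<^sub>R g \<xi>)"

definition spectral_barron_space :: "real \<Rightarrow> (real ^ 'd) set \<Rightarrow> (real ^ 'd \<Rightarrow> complex) set" where
  "spectral_barron_space s \<Omega> =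
     {f. continuous_on \<Omega> f \<and> bounded (f ` \<Omega>) \<and> (\<exists>fe g. spectral_extension s \<Omega> f fe g)}"

definition spectral_barron_norm :: "real \<Rightarrow> (real ^ 'd) set \<Rightarrow> (real ^ 'd \<Rightarrow> complex) \<Rightarrow> real" where
  "spectral_barron_norm s \<Omega> f =
     Inf {(LINT \<xi>|lborel. (1 + norm \<xi>) powr s * cmod (g \<xi>)) |fe g. spectral_extension s \<Omega> f fe g}"


section \<open>Functions modulo almost everywhere equality\<close>

definition ae_class ::
  "(real ^ 'd) set \<Rightarrow> (real ^ 'd \<Rightarrow> complex) \<Rightarrow> (real ^ 'd \<Rightarrow> complex) set" where
  "ae_class \<Omega> f = {h \<in> borel_measurable (lebesgue_on \<Omega>). AE x in lebesgue_on \<Omega>. h x = f x}"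

definition unit_cube :: "(real ^ 'd) set" where
  "unit_cube = {x. \<forall>i. 0 < x $ i \<and> x $ i < 1}"

end

theory Submission
  imports Defs "HOL-Probability.Characteristic_Functions" "HOL-Probability.Sinc_Integral"
begin

text \<open>
  Both spaces consist of superpositions of the exponentials \<open>x \<mapsto> exp (2 \<pi> i \<xi> \<bullet> x)\<close>, weighted by
  \<open>(1 + |\<xi>|)\<^sup>s\<close>. In the spectral space the superposition is given by a density \<open>g\<close>, in the Barron
  space by a measure \<open>\<rho>\<close> on the pairs \<open>(w, b)\<close>, where \<open>b\<close> only contributes a phase of modulus one.

  From spectral to Barron, Fourier inversion (\<open>fourier_inversion\<close>) writes the extension as
  \<open>fe x = \<integral> g \<xi> exp (2 \<pi> i \<xi> \<bullet> x) d\<xi>\<close>. So the measure \<open>g d\<xi>\<close>, placed on the hyperplane \<open>b = 0\<close>,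
  represents it, and the two weights differ only through comparing the \<open>l1\<close> norm with the Euclidean
  one; this costs the factor \<open>d powr s\<close>. The Fourier transform is given in the sense of tempered
  distributions, so inversion has to come from test functions: modulated Gaussians are Schwartz
  functions whose transforms form an approximate identity at the chosen point.

  From Barron to spectral, the transform of \<open>F x = \<integral> exp (2 \<pi> i (w \<bullet> x + b)) d\<rho>\<close> is in general a
  singular measure. Only the values on the bounded cube matter, however, so \<open>F\<close> may be multiplied by a
  cutoff \<open>\<kappa>\<close> that equals one there. The transform of \<open>\<kappa> F\<close> is the convolution of the transform of \<open>\<kappa>\<close>
  with the measure, hence a function, and submultiplicativity of the weight,
  \<open>1 + |\<xi> + w| \<le> (1 + |\<xi>|) (1 + |w|)\<close>, bounds its weighted \<open>L\<^sup>1\<close> norm by that of the transform of \<open>\<kappa>\<close>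
  times the Barron integral (\<open>fourier_bound_exponential_superposition\<close>). The cutoff is a product of
  functions of one variable, obtained from an interval by averaging often enough for the decay of its
  transform to beat the weight (\<open>cutoff_vec\<close>). Since \<open>\<kappa> F\<close> is integrable, the distributional
  transform agrees with the integral by Fubini alone.

  The integral against \<open>\<rho>\<close> is defined through the Jordan decompositions of its real and imaginary
  part. Its four positive measures are dominated by the total variation, which therefore controls
  everything that is needed of \<open>\<rho>\<close>.
\<close>

section \<open>Variations of complex measures\<close>

text \<open>The set function behind \<^const>\<open>total_variation\<close>; it is kept apart because it has to be shown to be
countably additive before the measure generated from it takes these values.\<close>

definition variation :: "'a measure \<Rightarrow> ('a set \<Rightarrow> complex) \<Rightarrow> 'a set \<Rightarrow> ennreal" where
  "variation M \<rho> A =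
     (SUP E\<in>{E::nat \<Rightarrow> 'a set. range E \<subseteq> sets M \<and> disjoint_family E \<and> (\<Union>i. E i) = A}.
        \<Sum>i. ennreal (cmod (\<rho> (E i))))"

lemma total_variation_eq: "total_variation M \<rho> = measure_of (space M) (sets M) (variation M \<rho>)"
  unfolding total_variation_def variation_def ..

lemma sets_total_variation [simp, measurable_cong]: "sets (total_variation M \<rho>) = sets M"
  by (simp add: total_variation_eq)

lemma space_total_variation [simp]: "space (total_variation M \<rho>) = space M"
  by (simp add: total_variation_eq)

lemma sets_positive_variation [simp, measurable_cong]: "sets (positive_variation M \<nu>) = sets M"
  by (simp add: positive_variation_def)

lemma space_positive_variation [simp]: "space (positive_variation M \<nu>) = space M"
  by (simp add: positive_variation_def)

lemma complex_measure_empty: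
  assumes "complex_measure M \<rho>"
  shows "\<rho> {} = 0"
proof -
  have "(\<lambda>i::nat. \<rho> {}) sums \<rho> {}"
    using assms[unfolded complex_measure_def, rule_format, of "\<lambda>_. {}"] by (simp add: disjoint_family_on_def)
  then show ?thesis
    using summable_const_iff sums_summable by metis
qed

lemma variation_upper:
  assumes "range E \<subseteq> sets M" "disjoint_family E" "(\<Union>i. E i) = A"
  shows "(\<Sum>i. ennreal (cmod (\<rho> (E i)))) \<le> variation M \<rho> A"
  unfolding variation_def using assms by (intro SUP_upper) auto

text \<open>The supremum is the limit along a sequence of partitions with increasing sums. This is the form in
which it commutes with an infinite sum, by monotone convergence.\<close>

lemma variation_approx:
  assumes "A \<in> sets M"
  shows "\<exists>E. (\<forall>n. range (E n) \<subseteq> sets M \<and> disjoint_family (E n) \<and> (\<Union>i. E n i) = A) \<and>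
    incseq (\<lambda>n. \<Sum>i. ennreal (cmod (\<rho> (E n i)))) \<and>
    variation M \<rho> A = (SUP n. \<Sum>i. ennreal (cmod (\<rho> (E n i))))"
proof -
  let ?P = "{E::nat \<Rightarrow> 'a set. range E \<subseteq> sets M \<and> disjoint_family E \<and> (\<Union>i. E i) = A}"
  let ?v = "\<lambda>E. \<Sum>i. ennreal (cmod (\<rho> (E i)))"
  have "(\<lambda>i::nat. if i = 0 then A else {}) \<in> ?P"
    using assms by (auto simp: disjoint_family_on_def split: if_splits)
  then have "?v ` ?P \<noteq> {}" by blast
  from ennreal_Sup_countable_SUP[OF this] obtain f :: "nat \<Rightarrow> ennreal"
    where f: "incseq f" "range f \<subseteq> ?v ` ?P" "Sup (?v ` ?P) = (SUP i. f i)" by blast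
  have "\<forall>n. \<exists>E. E \<in> ?P \<and> f n = ?v E"
  proof
    fix n
    have "f n \<in> ?v ` ?P" using f(2) rangeI by (rule subsetD)
    then show "\<exists>E. E \<in> ?P \<and> f n = ?v E" by (rule imageE) (rule exI, rule conjI)
  qed
  then have "\<exists>E. \<forall>n. E n \<in> ?P \<and> f n = ?v (E n)" by (rule choice)
  then obtain E where E: "\<forall>n. E n \<in> ?P \<and> f n = ?v (E n)" ..
  have fE: "f = (\<lambda>n. ?v (E n))" using E by (intro ext) (elim allE conjE)
  have "variation M \<rho> A = (SUP n. ?v (E n))"
    using f(3) unfolding fE variation_def .
  moreover have "incseq (\<lambda>n. ?v (E n))" using f(1) unfolding fE .
  moreover have "\<forall>n. range (E n) \<subseteq> sets M \<and> disjoint_family (E n) \<and> (\<Union>i. E n i) = A"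
    using E by simp
  ultimately show ?thesis by blast
qed

lemma complex_measure_cmod_le:
  assumes \<rho>: "complex_measure M \<rho>" and B: "B \<in> sets M" "B \<subseteq> (\<Union>i. A i)"
    and A: "range A \<subseteq> sets M" "disjoint_family A"
  shows "ennreal (cmod (\<rho> B)) \<le> (\<Sum>i. ennreal (cmod (\<rho> (B \<inter> A i))))"
proof -
  have "disjoint_family (\<lambda>i. B \<inter> A i)"
    using A(2) by (rule disjoint_family_subset) auto
  then have "(\<lambda>i. \<rho> (B \<inter> A i)) sums \<rho> (\<Union>i. B \<inter> A i)"
    using A(1) B(1) by (intro \<rho>[unfolded complex_measure_def, rule_format]) auto
  moreover have "(\<Union>i. B \<inter> A i) = B" using B by auto
  ultimately have "(\<lambda>n. cmod (\<Sum>i<n. \<rho> (B \<inter> A i))) \<longlonglongrightarrow> cmod (\<rho> B)"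
    by (intro tendsto_norm) (simp add: sums_def)
  then have "(\<lambda>n. ennreal (cmod (\<Sum>i<n. \<rho> (B \<inter> A i)))) \<longlonglongrightarrow> ennreal (cmod (\<rho> B))"
    by (intro tendsto_ennrealI)
  then show ?thesis
  proof (rule LIMSEQ_le_const2, intro exI allI impI)
    fix n
    have "ennreal (cmod (\<Sum>i<n. \<rho> (B \<inter> A i))) \<le> ennreal (\<Sum>i<n. cmod (\<rho> (B \<inter> A i)))"
      by (intro ennreal_leI norm_sum)
    also have "\<dots> = (\<Sum>i<n. ennreal (cmod (\<rho> (B \<inter> A i))))" by simp
    also have "\<dots> \<le> (\<Sum>i. ennreal (cmod (\<rho> (B \<inter> A i))))"
      by (intro sum_le_suminf) auto
    finally show "ennreal (cmod (\<Sum>i<n. \<rho> (B \<inter> A i))) \<le> (\<Sum>i. ennreal (cmod (\<rho> (B \<inter> A i))))" .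
  qed
qed

lemma suminf_ennreal_swap:
  fixes f :: "nat \<Rightarrow> nat \<Rightarrow> ennreal"
  shows "(\<Sum>i. \<Sum>j. f i j) = (\<Sum>j. \<Sum>i. f i j)"
  unfolding nn_integral_count_space_nat[symmetric]
  by (rule pair_sigma_finite.Fubini') (auto simp: pair_sigma_finite_def sigma_finite_measure_count_space pair_measure_countable)

text \<open>Partitions of the pieces \<open>A i\<close> combine to a partition of their union, indexed by pairs; conversely a
partition of the union is cut along the pieces, and \<open>\<rho>\<close> of each cell is the sum of its values on the
cuts.\<close>

lemma variation_countably_additive:
  assumes \<rho>: "complex_measure M \<rho>"
  shows "countably_additive (sets M) (variation M \<rho>)"
proof (rule countably_additiveI)
  fix A :: "nat \<Rightarrow> 'a set"
  assume A: "range A \<subseteq> sets M" "disjoint_family A" "(\<Union>i. A i) \<in> sets M"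
  have A': "A i \<in> sets M" for i using A by auto
  show "(\<Sum>i. variation M \<rho> (A i)) = variation M \<rho> (\<Union>i. A i)"
  proof (rule antisym)
    have "\<forall>i. \<exists>E. (\<forall>n. range (E n) \<subseteq> sets M \<and> disjoint_family (E n) \<and> (\<Union>j. E n j) = A i) \<and>
      incseq (\<lambda>n. \<Sum>j. ennreal (cmod (\<rho> (E n j)))) \<and>
      variation M \<rho> (A i) = (SUP n. \<Sum>j. ennreal (cmod (\<rho> (E n j))))"
      using variation_approx[OF A', of _ \<rho>] by blast
    from choice[OF this] obtain E where
      E: "\<And>i n. range (E i n) \<subseteq> sets M" "\<And>i n. disjoint_family (E i n)" "\<And>i n. (\<Union>j. E i n j) = A i"
      and inc: "\<And>i. incseq (\<lambda>n. \<Sum>j. ennreal (cmod (\<rho> (E i n j))))"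
      and sup: "\<And>i. variation M \<rho> (A i) = (SUP n. \<Sum>j. ennreal (cmod (\<rho> (E i n j))))"
      by metis
    have "(\<Sum>i. variation M \<rho> (A i)) = (SUP n. \<Sum>i. \<Sum>j. ennreal (cmod (\<rho> (E i n j))))"
      unfolding sup by (rule ennreal_suminf_SUP_eq) (rule inc)
    also have "\<dots> \<le> variation M \<rho> (\<Union>i. A i)"
    proof (rule SUP_least)
      fix n
      \<comment> \<open>The combined partition, enumerated through the pairing bijection.\<close>
      define D where "D k = (case prod_decode k of (i, j) \<Rightarrow> E i n j)" for k
      have "(\<Sum>i. \<Sum>j. ennreal (cmod (\<rho> (E i n j)))) =
          (\<Sum>k. (\<lambda>(i, j). ennreal (cmod (\<rho> (E i n j)))) (prod_decode k))"
        by (rule suminf_ennreal_2dimen[symmetric]) simp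
      also have "\<dots> = (\<Sum>k. ennreal (cmod (\<rho> (D k))))"
        by (simp add: D_def case_prod_beta)
      also have "\<dots> \<le> variation M \<rho> (\<Union>i. A i)"
      proof (rule variation_upper)
        show "range D \<subseteq> sets M" using E(1) by (force simp: D_def split: prod.splits)
        have "E i n j \<inter> E i' n j' = {}" if "(i, j) \<noteq> (i', j')" for i j i' j'
        proof (cases "i = i'")
          case True
          then show ?thesis using E(2)[of i n] that by (auto simp: disjoint_family_on_def)
        next
          case False
          then have "A i \<inter> A i' = {}" using A(2) by (auto simp: disjoint_family_on_def)
          moreover have "E i n j \<subseteq> A i" "E i' n j' \<subseteq> A i'" using E(3) by blast+
          ultimately show ?thesis by blast
        qed
        then show "disjoint_family D"
          unfolding disjoint_family_on_def D_def
          by (metis (no_types, lifting) case_prod_beta inj_prod_decode inj_eq prod.collapse UNIV_I)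
        have "(\<Union>k. D k) = (\<Union>p. case p of (i, j) \<Rightarrow> E i n j)"
          unfolding D_def using surj_prod_decode by (metis (no_types) image_image)
        also have "\<dots> = (\<Union>i. \<Union>j. E i n j)" by auto
        finally show "(\<Union>k. D k) = (\<Union>i. A i)" using E(3) by simp
      qed
      finally show "(\<Sum>i. \<Sum>j. ennreal (cmod (\<rho> (E i n j)))) \<le> variation M \<rho> (\<Union>i. A i)" .
    qed
    finally show "(\<Sum>i. variation M \<rho> (A i)) \<le> variation M \<rho> (\<Union>i. A i)" .
  next
    show "variation M \<rho> (\<Union>i. A i) \<le> (\<Sum>i. variation M \<rho> (A i))"
      unfolding variation_def[of M \<rho> "\<Union>i. A i"]
    proof (rule SUP_least, clarify)
      fix E :: "nat \<Rightarrow> 'a set"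
      assume E: "range E \<subseteq> sets M" "disjoint_family E" "(\<Union>i. E i) = (\<Union>i. A i)"
      have E': "E j \<in> sets M" "E j \<subseteq> (\<Union>i. A i)" for j
        using E(1) E(3) by blast+
      have "(\<Sum>j. ennreal (cmod (\<rho> (E j)))) \<le> (\<Sum>j. \<Sum>i. ennreal (cmod (\<rho> (E j \<inter> A i))))"
        by (intro suminf_le complex_measure_cmod_le[OF \<rho> E' A(1,2)]) simp_all
      also have "\<dots> = (\<Sum>i. \<Sum>j. ennreal (cmod (\<rho> (E j \<inter> A i))))"
        by (rule suminf_ennreal_swap)
      also have "\<dots> \<le> (\<Sum>i. variation M \<rho> (A i))"
      proof (intro suminf_le variation_upper)
        fix i
        show "range (\<lambda>j. E j \<inter> A i) \<subseteq> sets M" using E'(1) A' by auto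
        show "disjoint_family (\<lambda>j. E j \<inter> A i)" using E(2) by (rule disjoint_family_subset) auto
        show "(\<Union>j. E j \<inter> A i) = A i" using E(3) by blast
      qed simp_all
      finally show "(\<Sum>j. ennreal (cmod (\<rho> (E j)))) \<le> (\<Sum>i. variation M \<rho> (A i))" .
    qed
  qed
qed

lemma variation_empty:
  assumes "complex_measure M \<rho>"
  shows "variation M \<rho> {} = 0"
  using complex_measure_empty[OF assms] unfolding variation_def
  by (intro antisym SUP_least) auto

lemma emeasure_total_variation:
  assumes "complex_measure M \<rho>" "A \<in> sets M"
  shows "emeasure (total_variation M \<rho>) A = variation M \<rho> A"
  unfolding total_variation_eq
  by (intro emeasure_measure_of_sigma sets.sigma_algebra_axioms variation_countably_additive assms)
    (auto simp: positive_def variation_empty assms)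

text \<open>If \<open>\<mu>\<close> is countably additive, the generated measure agrees with it; otherwise the generated measure is zero.\<close>

lemma emeasure_measure_of_le:
  "emeasure (measure_of \<Omega> \<A> \<mu>) B \<le> \<mu> B"
  by (simp add: emeasure_measure_of_conv)

text \<open>A subset \<open>B\<close> of \<open>A\<close> is a cell of the partition of \<open>A\<close> into \<open>B\<close> and \<open>A - B\<close>, so the
variation of \<open>A\<close> bounds \<open>|\<rho> B|\<close>. The lemma is applied to the real
and imaginary parts of \<open>\<rho>\<close> and their negatives.\<close>

lemma positive_variation_le_total_variation:
  assumes \<rho>: "complex_measure M \<rho>" and \<nu>: "\<And>B. B \<in> sets M \<Longrightarrow> \<nu> B \<le> cmod (\<rho> B)"
  shows "positive_variation M \<nu> \<le> total_variation M \<rho>"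
proof (subst le_measure)
  show "\<forall>A\<in>sets (positive_variation M \<nu>).
      emeasure (positive_variation M \<nu>) A \<le> emeasure (total_variation M \<rho>) A"
  proof
    fix A assume "A \<in> sets (positive_variation M \<nu>)"
    then have A: "A \<in> sets M" by simp
    have "emeasure (positive_variation M \<nu>) A \<le> (SUP B\<in>{B \<in> sets M. B \<subseteq> A}. ennreal (\<nu> B))"
      unfolding positive_variation_def by (rule emeasure_measure_of_le)
    also have "\<dots> \<le> emeasure (total_variation M \<rho>) A"
    proof (rule SUP_least, clarify)
      fix B assume B: "B \<in> sets M" "B \<subseteq> A"
      \<comment> \<open>The partition into \<open>B\<close> and \<open>A - B\<close>, continued by empty sets.\<close>
      let ?E = "\<lambda>i::nat. if i = 0 then B else if i = 1 then A - B else {}"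
      have "ennreal (\<nu> B) \<le> ennreal (cmod (\<rho> (?E 0)))" using B \<nu> by (simp add: ennreal_leI)
      also have "\<dots> = (\<Sum>i\<in>{0}. ennreal (cmod (\<rho> (?E i))))" by simp
      also have "\<dots> \<le> (\<Sum>i. ennreal (cmod (\<rho> (?E i))))" by (intro sum_le_suminf) auto
      also have "\<dots> \<le> variation M \<rho> A"
        using A B by (intro variation_upper) (auto simp: disjoint_family_on_def split: if_splits)
      finally show "ennreal (\<nu> B) \<le> emeasure (total_variation M \<rho>) A"
        using A \<rho> by (simp add: emeasure_total_variation)
    qed
    finally show "emeasure (positive_variation M \<nu>) A \<le> emeasure (total_variation M \<rho>) A" .
  qed
qed simp

lemma complex_measure_density:
  fixes G :: "'a \<Rightarrow> complex"
  assumes G: "integrable M G" and N: "sets N = sets M"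
  shows "complex_measure N (\<lambda>A. LINT x:A|M. G x)"
  unfolding complex_measure_def N
proof (intro allI impI)
  fix A :: "nat \<Rightarrow> 'a set" assume A: "range A \<subseteq> sets M" "disjoint_family A"
  have "set_integrable M (\<Union>i. A i) G"
    unfolding set_integrable_def using A G by (intro integrable_mult_indicator) auto
  moreover have "(\<Union>n. \<Union>i<n. A i) = (\<Union>i. A i)" by auto
  ultimately have "(\<lambda>n. LINT x:(\<Union>i<n. A i)|M. G x) \<longlonglongrightarrow> (LINT x:(\<Union>n. \<Union>i<n. A i)|M. G x)"
    using A by (intro set_integral_cont_up) (auto simp: incseq_def intro: less_le_trans)
  moreover have "(LINT x:(\<Union>i<n. A i)|M. G x) = (\<Sum>i<n. LINT x:A i|M. G x)" for n
    using A G by (intro set_integral_finite_Union)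
      (auto simp: set_integrable_def disjoint_family_on_def intro!: integrable_mult_indicator)
  ultimately show "(\<lambda>i. LINT x:A i|M. G x) sums (LINT x:(\<Union>i. A i)|M. G x)"
    using \<open>(\<Union>n. \<Union>i<n. A i) = (\<Union>i. A i)\<close> by (simp add: sums_def)
qed

lemma total_variation_density_le:
  fixes G :: "'a \<Rightarrow> complex"
  assumes G: "integrable M G" and N: "sets N = sets M"
  shows "total_variation N (\<lambda>A. LINT x:A|M. G x) \<le> density M (\<lambda>x. ennreal (cmod (G x)))"
proof -
  note [measurable] = borel_measurable_integrable[OF G]
  show ?thesis
  proof (subst le_measure)
    let ?\<rho> = "\<lambda>A. LINT x:A|M. G x"
    let ?D = "density M (\<lambda>x. ennreal (cmod (G x)))"
    show "\<forall>A\<in>sets (total_variation N ?\<rho>). emeasure (total_variation N ?\<rho>) A \<le> emeasure ?D A"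
    proof
      fix A assume "A \<in> sets (total_variation N ?\<rho>)"
      have "emeasure (total_variation N ?\<rho>) A \<le> variation N ?\<rho> A"
        unfolding total_variation_eq by (rule emeasure_measure_of_le)
      also have "\<dots> \<le> emeasure ?D A"
        unfolding variation_def
      proof (rule SUP_least, clarify)
        fix E :: "nat \<Rightarrow> 'a set" assume E: "range E \<subseteq> sets N" "disjoint_family E"
        have "ennreal (cmod (?\<rho> (E i))) \<le> emeasure ?D (E i)" for i
        proof -
          have [measurable]: "E i \<in> sets M" using E N by auto
          have "ennreal (cmod (?\<rho> (E i))) \<le> (\<integral>\<^sup>+x. norm (indicator (E i) x *\<^sub>R G x) \<partial>M)"
            unfolding set_lebesgue_integral_def
            using G by (intro integral_norm_bound_ennreal integrable_mult_indicator) auto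
          also have "\<dots> = emeasure ?D (E i)"
            by (subst emeasure_density) (auto intro!: nn_integral_cong split: split_indicator)
          finally show ?thesis .
        qed
        then have "(\<Sum>i. ennreal (cmod (?\<rho> (E i)))) \<le> (\<Sum>i. emeasure ?D (E i))"
          by (intro suminf_le) auto
        also have "\<dots> = emeasure ?D (\<Union>i. E i)"
          using E N by (intro suminf_emeasure) auto
        finally show "(\<Sum>i. ennreal (cmod (?\<rho> (E i)))) \<le> emeasure ?D (\<Union>i. E i)" .
      qed
      finally show "emeasure (total_variation N ?\<rho>) A \<le> emeasure ?D A" .
    qed
  qed (simp add: N)
qed

text \<open>The supremum over subsets of \<open>A\<close> is attained on the part of \<open>A\<close> where the density is positive.\<close>

lemma positive_variation_density:
  fixes h :: "'a \<Rightarrow> real"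
  assumes h: "integrable M h" and N: "sets N = sets M"
    and \<nu>: "\<And>A. A \<in> sets M \<Longrightarrow> \<nu> A = (LINT x:A|M. h x)"
  shows "positive_variation N \<nu> = density M (\<lambda>x. ennreal (h x))"
proof -
  note [measurable] = borel_measurable_integrable[OF h]
  let ?D = "density M (\<lambda>x. ennreal (h x))"
  have sp: "space N = space M" using N by (rule sets_eq_imp_space_eq)
  have int: "integrable M (\<lambda>x. indicator B x * h x)" if "B \<in> sets M" for B
    using integrable_mult_indicator[OF that h] by simp
  have "(SUP B\<in>{B \<in> sets N. B \<subseteq> A}. ennreal (\<nu> B)) = emeasure ?D A" if A: "A \<in> sets M" for A
  proof (rule antisym)
    show "(SUP B\<in>{B \<in> sets N. B \<subseteq> A}. ennreal (\<nu> B)) \<le> emeasure ?D A"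
    proof (rule SUP_least, clarify)
      fix B assume "B \<in> sets N" and BA: "B \<subseteq> A"
      then have B[measurable]: "B \<in> sets M" using N by simp
      have i2: "integrable M (\<lambda>x. max 0 (indicator B x * h x))" using int[OF B] by auto
      have "ennreal (\<nu> B) \<le> ennreal (LINT x|M. max 0 (indicator B x * h x))"
        unfolding \<nu>[OF B] set_lebesgue_integral_def
        using int[OF B] i2 by (intro ennreal_leI integral_mono) auto
      also have "\<dots> = (\<integral>\<^sup>+x. ennreal (max 0 (indicator B x * h x)) \<partial>M)"
        by (rule nn_integral_eq_integral[symmetric]) (use i2 in auto)
      also have "\<dots> = emeasure ?D B"
        by (subst emeasure_density) (auto intro!: nn_integral_cong split: split_indicator simp: max_def ennreal_neg)
      also have "\<dots> \<le> emeasure ?D A" using A BA by (intro emeasure_mono) auto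
      finally show "ennreal (\<nu> B) \<le> emeasure ?D A" .
    qed
    define B where "B = A \<inter> {x \<in> space M. 0 < h x}"
    have B[measurable]: "B \<in> sets M" using A unfolding B_def by measurable
    have nn: "0 \<le> indicator B x * h x" for x by (auto simp: B_def split: split_indicator)
    have "emeasure ?D A = (\<integral>\<^sup>+x. ennreal (indicator B x * h x) \<partial>M)"
      using A by (subst emeasure_density)
        (auto intro!: nn_integral_cong split: split_indicator simp: B_def ennreal_neg)
    also have "\<dots> = ennreal (\<nu> B)"
      unfolding \<nu>[OF B] set_lebesgue_integral_def
      using nn int[OF B] by (subst nn_integral_eq_integral) auto
    also have "\<dots> \<le> (SUP B\<in>{B \<in> sets N. B \<subseteq> A}. ennreal (\<nu> B))"
      using B N by (intro SUP_upper) (auto simp: B_def)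
    finally show "emeasure ?D A \<le> (SUP B\<in>{B \<in> sets N. B \<subseteq> A}. ennreal (\<nu> B))" .
  qed
  then have "positive_variation N \<nu> = measure_of (space M) (sets M) (emeasure ?D)"
    unfolding positive_variation_def sp N
    by (intro measure_of_eq sets.space_closed) (simp add: sets.sigma_sets_eq)
  also have "\<dots> = ?D" using measure_of_of_measure[of ?D] by simp
  finally show ?thesis .
qed

lemma integral_density_pos_neg:
  fixes f :: "'a \<Rightarrow> complex" and h :: "'a \<Rightarrow> real"
  assumes h: "integrable M h" and f[measurable]: "f \<in> borel_measurable M" and hf: "integrable M (\<lambda>x. h x *\<^sub>R f x)"
  shows "integral\<^sup>L (density M (\<lambda>x. ennreal (h x))) f - integral\<^sup>L (density M (\<lambda>x. ennreal (- h x))) f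
    = (LINT x|M. h x *\<^sub>R f x)"
proof -
  note [measurable] = borel_measurable_integrable[OF h]
  have D: "density M (\<lambda>x. ennreal (k x)) = density M (\<lambda>x. ennreal (max 0 (k x)))"
    if "k \<in> borel_measurable M" for k
    using that by (intro density_cong) (auto simp: max_def ennreal_neg)
  have 1: "integrable M (\<lambda>x. max 0 (h x) *\<^sub>R f x)" "integrable M (\<lambda>x. max 0 (- h x) *\<^sub>R f x)"
    by (auto intro!: Bochner_Integration.integrable_bound[OF hf] mult_right_mono mult_nonpos_nonneg AE_I2
        simp: max_def)
  have "integral\<^sup>L (density M (\<lambda>x. ennreal (h x))) f - integral\<^sup>L (density M (\<lambda>x. ennreal (- h x))) f
     = (LINT x|M. max 0 (h x) *\<^sub>R f x) - (LINT x|M. max 0 (- h x) *\<^sub>R f x)"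
    using D[of h] D[of "\<lambda>x. - h x"] integral_density[of f M "\<lambda>x. max 0 (h x)"]
      integral_density[of f M "\<lambda>x. max 0 (- h x)"] by simp
  also have "\<dots> = (LINT x|M. max 0 (h x) *\<^sub>R f x - max 0 (- h x) *\<^sub>R f x)"
    using 1 by simp
  also have "\<dots> = (LINT x|M. h x *\<^sub>R f x)"
    by (intro Bochner_Integration.integral_cong) (auto simp: max_def)
  finally show ?thesis .
qed

text \<open>The Jordan parts of a measure with a real density have the positive and negative part of the density
as their densities, so the four integrals recombine to the integral of \<open>G * f\<close>.\<close>

lemma complex_integral_density:
  fixes G f :: "'a \<Rightarrow> complex"
  assumes G: "integrable M G" and N: "sets N = sets M"
    and f[measurable]: "f \<in> borel_measurable M" and Gf: "integrable M (\<lambda>x. G x * f x)"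
  shows "complex_integral N (\<lambda>A. LINT x:A|M. G x) f = (LINT x|M. G x * f x)"
proof -
  note [measurable] = borel_measurable_integrable[OF G]
  have int: "integrable M (\<lambda>x. indicator A x *\<^sub>R G x)" if "A \<in> sets M" for A
    using integrable_mult_indicator[OF that G] .
  have R: "Re (LINT x:A|M. G x) = (LINT x:A|M. Re (G x))"
    and I: "Im (LINT x:A|M. G x) = (LINT x:A|M. Im (G x))" if "A \<in> sets M" for A
    unfolding set_lebesgue_integral_def using int[OF that] by (simp_all flip: integral_Re integral_Im)
  have neg: "- (LINT x:A|M. k x) = (LINT x:A|M. - k x)" for A and k :: "'a \<Rightarrow> real"
    by (simp add: set_lebesgue_integral_def)
  have iR: "integrable M (\<lambda>x. Re (G x))" and iI: "integrable M (\<lambda>x. Im (G x))" using G by auto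
  have Rf: "integrable M (\<lambda>x. Re (G x) *\<^sub>R f x)"
    by (rule Bochner_Integration.integrable_bound[OF Gf]) (auto simp: norm_mult abs_Re_le_cmod intro!: mult_right_mono)
  have If: "integrable M (\<lambda>x. Im (G x) *\<^sub>R f x)"
    by (rule Bochner_Integration.integrable_bound[OF Gf]) (auto simp: norm_mult abs_Im_le_cmod intro!: mult_right_mono)
  have "complex_integral N (\<lambda>A. LINT x:A|M. G x) f =
      (LINT x|M. Re (G x) *\<^sub>R f x) + \<i> * (LINT x|M. Im (G x) *\<^sub>R f x)"
    unfolding complex_integral_def signed_integral_def
    using iR iI N Rf If
    by (simp add: R I neg positive_variation_density[where M=M and h="\<lambda>x. Re (G x)"]
        positive_variation_density[where M=M and h="\<lambda>x. Im (G x)"]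
        positive_variation_density[where M=M and h="\<lambda>x. - Re (G x)"]
        positive_variation_density[where M=M and h="\<lambda>x. - Im (G x)"] integral_density_pos_neg)
  also have "\<dots> = (LINT x|M. Re (G x) *\<^sub>R f x + \<i> * (Im (G x) *\<^sub>R f x))"
    using Rf integrable_mult_right[OF If, of \<i>]
    by (simp add: Bochner_Integration.integral_add del: mult_scaleR_right)
  also have "\<dots> = (LINT x|M. G x * f x)"
    by (intro Bochner_Integration.integral_cong refl)
      (simp add: complex_eq_iff)
  finally show ?thesis .
qed

section \<open>Lebesgue measure on coordinates and Schwartz functions\<close>

text \<open>Lebesgue measure is built as a product over the canonical basis, whereas the functions of interest
are products over the coordinate indices; this translates between the two indexings.\<close>

lemma prod_Basis_vec:
  fixes f :: "'d::finite \<Rightarrow> real \<Rightarrow> 'b::comm_monoid_mult" and x :: "real ^ 'd"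
  shows "(\<Prod>b\<in>Basis. f (inv (\<lambda>i. axis i 1) b) (x \<bullet> b)) = (\<Prod>i\<in>UNIV. f i (x $ i))"
proof -
  have inj: "inj (\<lambda>i::'d. axis i (1::real))" by (auto simp: inj_on_def axis_eq_axis)
  have Basis: "(Basis :: (real ^ 'd) set) = range (\<lambda>i. axis i 1)" by (auto simp: Basis_vec_def)
  show ?thesis
    unfolding Basis by (subst prod.reindex[OF inj]) (simp add: inv_f_f[OF inj] inner_axis)
qed

lemma
  fixes f :: "'d::finite \<Rightarrow> real \<Rightarrow> 'b::{real_normed_field,banach,second_countable_topology}"
  assumes f: "\<And>i. integrable lborel (f i)"
  shows integrable_lborel_prod_vec: "integrable lborel (\<lambda>x::real ^ 'd. \<Prod>i\<in>UNIV. f i (x $ i))"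
    and integral_lborel_prod_vec:
      "(LINT x|lborel. (\<Prod>i\<in>UNIV. f i ((x::real ^ 'd) $ i))) = (\<Prod>i\<in>UNIV. LINT t|lborel. f i t)"
proof -
  interpret product_sigma_finite "\<lambda>_::real ^ 'd. lborel :: real measure"
    by standard
  let ?g = "\<lambda>b::real ^ 'd. f (inv (\<lambda>i. axis i 1) b)"
  have [measurable]: "f i \<in> borel_measurable borel" for i
    using borel_measurable_integrable[OF f] by simp
  have [measurable]: "(\<lambda>h. \<Sum>b\<in>Basis. h b *\<^sub>R b) \<in> measurable (\<Pi>\<^sub>M b\<in>Basis. lborel) (borel :: (real ^ 'd) measure)"
    by measurable
  have meas: "(\<lambda>x::real ^ 'd. \<Prod>i\<in>UNIV. f i (x $ i)) \<in> borel_measurable borel"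
    by measurable
  have eq: "(\<Prod>i\<in>UNIV. f i ((\<Sum>b\<in>Basis. h b *\<^sub>R b :: real ^ 'd) $ i)) = (\<Prod>b\<in>Basis. ?g b (h b))" for h
    unfolding prod_Basis_vec[symmetric] by (intro prod.cong refl) simp
  have "integrable (\<Pi>\<^sub>M b\<in>Basis. lborel) (\<lambda>h. \<Prod>b\<in>Basis. ?g b (h b))"
    by (intro product_integrable_prod f) simp
  then show "integrable lborel (\<lambda>x::real ^ 'd. \<Prod>i\<in>UNIV. f i (x $ i))"
    by (subst lborel_eq, subst integrable_distr_eq) (use meas in \<open>simp_all add: eq del: sum_component vector_scaleR_component\<close>)
  have "(LINT x|lborel. (\<Prod>i\<in>UNIV. f i ((x::real ^ 'd) $ i))) =
      (LINT h|(\<Pi>\<^sub>M b\<in>Basis. lborel). (\<Prod>b\<in>Basis. ?g b (h b)))"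
    by (subst lborel_eq, subst integral_distr) (use meas in \<open>simp_all add: eq del: sum_component vector_scaleR_component\<close>)
  also have "\<dots> = (\<Prod>b\<in>(Basis :: (real ^ 'd) set). LINT t|lborel. ?g b t)"
    by (intro product_integral_prod f) simp
  also have "\<dots> = (\<Prod>i\<in>UNIV. LINT t|lborel. f i t)"
    using prod_Basis_vec[of "\<lambda>i _. LINT t|lborel. f i t"] .
  finally show "(LINT x|lborel. (\<Prod>i\<in>UNIV. f i ((x::real ^ 'd) $ i))) = (\<Prod>i\<in>UNIV. LINT t|lborel. f i t)" .
qed

lemma integrable_inverse_one_plus_square: "integrable lborel (\<lambda>t::real. inverse (1 + t\<^sup>2))"
  using integrable_inverse_1_plus_square by (simp add: set_integrable_def)

lemma schwartz_continuous:
  assumes "\<psi> \<in> schwartz_space"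
  shows "continuous_on UNIV \<psi>"
proof -
  have "iterated_partial [] \<psi> differentiable (at x)" for x
    using assms unfolding schwartz_space_def by blast
  then show ?thesis
    by (auto simp: continuous_on_eq_continuous_at intro: differentiable_imp_continuous_within)
qed

text \<open>Decay of order \<open>2 d\<close> suffices, since \<open>(1 + |x|)\<^sup>2\<close> dominates each factor of \<open>\<Prod>i. 1 + (x $ i)\<^sup>2\<close>,
whose inverse is integrable coordinate by coordinate.\<close>

lemma schwartz_integrable:
  fixes \<psi> :: "real ^ 'd \<Rightarrow> complex"
  assumes \<psi>: "\<psi> \<in> schwartz_space"
  shows "integrable lborel \<psi>"
proof -
  let ?k = "2 * CARD('d)"
  have "bounded (range (\<lambda>x. (1 + norm x) ^ ?k *\<^sub>R iterated_partial [] \<psi> x))"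
    using \<psi> unfolding schwartz_space_def by blast
  then obtain C where C: "\<And>x. norm ((1 + norm x) ^ ?k *\<^sub>R \<psi> x) \<le> C"
    by (auto simp: bounded_iff)
  have bound: "norm (\<psi> x) \<le> norm (C * (\<Prod>i\<in>UNIV. inverse (1 + (x $ i)\<^sup>2)))" for x
  proof -
    have "(\<Prod>i\<in>UNIV. 1 + (x $ i)\<^sup>2) \<le> (\<Prod>i\<in>(UNIV::'d set). (1 + norm x)\<^sup>2)"
    proof (intro prod_mono conjI)
      fix i
      have "(x $ i)\<^sup>2 \<le> (norm x)\<^sup>2" using component_le_norm_cart[of x i] abs_le_square_iff by fastforce
      then show "1 + (x $ i)\<^sup>2 \<le> (1 + norm x)\<^sup>2"
        by (simp add: power2_sum add_increasing2)
    qed simp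
    also have "\<dots> = (1 + norm x) ^ ?k" by (simp add: power_mult)
    finally have le: "(\<Prod>i\<in>UNIV. 1 + (x $ i)\<^sup>2) \<le> (1 + norm x) ^ ?k" .
    have pos: "0 < (\<Prod>i\<in>UNIV. 1 + (x $ i)\<^sup>2)" by (intro prod_pos) (simp add: add_pos_nonneg)
    have "(\<Prod>i\<in>UNIV. 1 + (x $ i)\<^sup>2) * norm (\<psi> x) \<le> (1 + norm x) ^ ?k * norm (\<psi> x)"
      using le by (rule mult_right_mono) simp
    also have "\<dots> \<le> C" using C[of x] by simp
    finally have "norm (\<psi> x) \<le> C * (\<Prod>i\<in>UNIV. inverse (1 + (x $ i)\<^sup>2))"
      using pos prod_inversef[of "\<lambda>i. 1 + (x $ i)\<^sup>2" UNIV] by (simp add: o_def field_simps)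
    then show ?thesis by simp
  qed
  have "integrable lborel (\<lambda>x::real ^ 'd. C * (\<Prod>i\<in>UNIV. inverse (1 + (x $ i)\<^sup>2)))"
    by (intro integrable_mult_right integrable_lborel_prod_vec integrable_inverse_one_plus_square)
  then show ?thesis
    by (rule Bochner_Integration.integrable_bound)
      (use bound borel_measurable_continuous_onI[OF schwartz_continuous[OF \<psi>]] in auto)
qed

section \<open>Gaussian test functions\<close>

text \<open>Complex polynomials in the coordinates. Their only purpose is that the products \<open>p \<cdot> exp l\<close> with a
fixed polynomial \<open>l\<close> are closed under partial derivatives.\<close>

inductive_set polynomial_fun :: "(real ^ 'd \<Rightarrow> complex) set" where
  const: "(\<lambda>_. c) \<in> polynomial_fun"
| coord: "(\<lambda>x. complex_of_real (x $ i)) \<in> polynomial_fun"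
| add: "p \<in> polynomial_fun \<Longrightarrow> q \<in> polynomial_fun \<Longrightarrow> (\<lambda>x. p x + q x) \<in> polynomial_fun"
| mult: "p \<in> polynomial_fun \<Longrightarrow> q \<in> polynomial_fun \<Longrightarrow> (\<lambda>x. p x * q x) \<in> polynomial_fun"

lemma polynomial_fun_sum:
  assumes "\<And>i. i \<in> I \<Longrightarrow> p i \<in> polynomial_fun"
  shows "(\<lambda>x. \<Sum>i\<in>I. p i x) \<in> polynomial_fun"
  using assms by (induction I rule: infinite_finite_induct) (auto intro: polynomial_fun.intros)

lemma polynomial_fun_differentiable:
  "p \<in> polynomial_fun \<Longrightarrow> p differentiable (at x)"
proof (induction rule: polynomial_fun.induct)
  case (coord i)
  have "bounded_linear (\<lambda>x::real ^ 'a. complex_of_real (x $ i))"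
    by (rule bounded_linear_compose[OF bounded_linear_of_real bounded_linear_vec_nth])
  then show ?case by (rule bounded_linear_imp_differentiable)
qed (auto intro: differentiable_add differentiable_mult)

lemma polynomial_fun_partial:
  "p \<in> polynomial_fun \<Longrightarrow> \<exists>q\<in>polynomial_fun. \<forall>x.
     ((\<lambda>t. p (x + t *\<^sub>R axis i 1)) has_vector_derivative q x) (at 0)"
proof (induction rule: polynomial_fun.induct)
  case (const c)
  show ?case by (intro bexI[of _ "\<lambda>_. 0"] polynomial_fun.const) simp
next
  case (coord j)
  have "((\<lambda>t. complex_of_real (x $ j) + t *\<^sub>R complex_of_real ((axis i 1 :: real ^ 'a) $ j)) has_vector_derivative
      complex_of_real ((axis i 1 :: real ^ 'a) $ j)) (at 0)" for x :: "real ^ 'a"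
    by (auto intro!: derivative_eq_intros)
  then show ?case
    by (intro bexI[of _ "\<lambda>_. complex_of_real ((axis i 1 :: real ^ 'a) $ j)"] polynomial_fun.const)
      (simp add: scaleR_conv_of_real[where 'a=complex])
next
  case (add p q)
  then obtain p' q' where "p' \<in> polynomial_fun" "q' \<in> polynomial_fun"
    "\<And>x. ((\<lambda>t. p (x + t *\<^sub>R axis i 1)) has_vector_derivative p' x) (at 0)"
    "\<And>x. ((\<lambda>t. q (x + t *\<^sub>R axis i 1)) has_vector_derivative q' x) (at 0)" by blast
  then show ?case
    by (intro bexI[of _ "\<lambda>x. p' x + q' x"] polynomial_fun.add allI has_vector_derivative_add)
next
  case (mult p q)
  then obtain p' q' where *: "p' \<in> polynomial_fun" "q' \<in> polynomial_fun"
    "\<And>x. ((\<lambda>t. p (x + t *\<^sub>R axis i 1)) has_vector_derivative p' x) (at 0)"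
    "\<And>x. ((\<lambda>t. q (x + t *\<^sub>R axis i 1)) has_vector_derivative q' x) (at 0)" by blast
  have "((\<lambda>t. p (x + t *\<^sub>R axis i 1) * q (x + t *\<^sub>R axis i 1)) has_vector_derivative
      p x * q' x + p' x * q x) (at 0)" for x
    using has_vector_derivative_mult[OF *(3)[of x] *(4)[of x]] by simp
  then show ?case using * mult
    by (intro bexI[of _ "\<lambda>x. p x * q' x + p' x * q x"] polynomial_fun.add polynomial_fun.mult allI)
qed

lemma polynomial_fun_growth:
  "p \<in> polynomial_fun \<Longrightarrow> \<exists>C m. \<forall>x. norm (p x) \<le> C * (1 + norm x) ^ m"
proof (induction rule: polynomial_fun.induct)
  case (const c)
  show ?case by (intro exI[of _ "norm c"] exI[of _ 0]) simp
next
  case (coord i)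
  show ?case
    by (intro exI[of _ 1] exI[of _ 1] allI) (simp add: add_increasing component_le_norm_cart)
next
  case (add p q)
  then obtain C m D n where *: "\<And>x. norm (p x) \<le> C * (1 + norm x) ^ m" "\<And>x. norm (q x) \<le> D * (1 + norm x) ^ n"
    by blast
  have "norm (p x + q x) \<le> (\<bar>C\<bar> + \<bar>D\<bar>) * (1 + norm x) ^ (m + n)" for x
  proof -
    have "norm (p x + q x) \<le> C * (1 + norm x) ^ m + D * (1 + norm x) ^ n"
      using * norm_triangle_le add_mono by blast
    also have "\<dots> \<le> \<bar>C\<bar> * (1 + norm x) ^ (m + n) + \<bar>D\<bar> * (1 + norm x) ^ (m + n)"
      by (intro add_mono mult_mono power_increasing) auto
    finally show ?thesis by (simp add: algebra_simps)
  qed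
  then show ?case by blast
next
  case (mult p q)
  then obtain C m D n where *: "\<And>x. norm (p x) \<le> C * (1 + norm x) ^ m" "\<And>x. norm (q x) \<le> D * (1 + norm x) ^ n"
    by blast
  have "norm (p x * q x) \<le> (C * D) * (1 + norm x) ^ (m + n)" for x
  proof -
    have "norm (p x * q x) \<le> (C * (1 + norm x) ^ m) * (D * (1 + norm x) ^ n)"
      unfolding norm_mult using * order_trans[OF norm_ge_zero *(1)] by (intro mult_mono) auto
    then show ?thesis by (simp add: power_add mult_ac)
  qed
  then show ?case by blast
qed

lemma iterated_partial_polynomial_exp:
  assumes l: "l \<in> polynomial_fun" and p: "p \<in> polynomial_fun"
  shows "\<exists>q\<in>polynomial_fun. iterated_partial is (\<lambda>x. p x * exp (l x)) = (\<lambda>x. q x * exp (l x))"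
proof (induction "is")
  case Nil
  show ?case using p by auto
next
  case (Cons i "is")
  then obtain q where q: "q \<in> polynomial_fun"
    and eq: "iterated_partial is (\<lambda>x. p x * exp (l x)) = (\<lambda>x. q x * exp (l x))" by blast
  obtain q' l' where *: "q' \<in> polynomial_fun" "l' \<in> polynomial_fun"
    "\<And>x. ((\<lambda>t. q (x + t *\<^sub>R axis i 1)) has_vector_derivative q' x) (at 0)"
    "\<And>x. ((\<lambda>t. l (x + t *\<^sub>R axis i 1)) has_vector_derivative l' x) (at 0)"
    using polynomial_fun_partial[OF q, of i] polynomial_fun_partial[OF l, of i] by blast
  have "((\<lambda>t. q (x + t *\<^sub>R axis i 1) * exp (l (x + t *\<^sub>R axis i 1))) has_vector_derivative
      (q' x + q x * l' x) * exp (l x)) (at 0)" for x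
  proof -
    have "((\<lambda>t. exp (l (x + t *\<^sub>R axis i 1))) has_vector_derivative l' x * exp (l x)) (at 0)"
      using field_vector_diff_chain_at[OF *(4)[of x], of exp "exp (l x)"] DERIV_exp by (simp add: o_def)
    from has_vector_derivative_mult[OF *(3)[of x] this] show ?thesis
      by (simp add: algebra_simps)
  qed
  then have "partial_deriv i (\<lambda>x. q x * exp (l x)) = (\<lambda>x. (q' x + q x * l' x) * exp (l x))"
    unfolding partial_deriv_def by (intro ext vector_derivative_at)
  then show ?case using * q
    by (intro bexI[of _ "\<lambda>x. q' x + q x * l' x"] polynomial_fun.add polynomial_fun.mult) (auto simp: eq)
qed

text \<open>Every iterated derivative is \<open>q \<cdot> exp l\<close> with a polynomial \<open>q\<close>, and a Gaussian bound beats polynomial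
growth: \<open>(1 + r)\<^sup>n \<le> exp (n r)\<close>, while \<open>n r - a r\<^sup>2 \<le> n\<^sup>2 / (4 a)\<close> by completing the square.\<close>

lemma exp_polynomial_schwartz:
  assumes l: "l \<in> polynomial_fun" and a: "a > 0" and Re: "\<And>x. Re (l x) \<le> - a * (norm x)\<^sup>2"
  shows "(\<lambda>x. exp (l x)) \<in> schwartz_space"
proof -
  have ip: "\<exists>q\<in>polynomial_fun. iterated_partial is (\<lambda>x. exp (l x)) = (\<lambda>x. q x * exp (l x))" for "is"
    using iterated_partial_polynomial_exp[OF l polynomial_fun.const[of 1]] by simp
  have exp_l: "(\<lambda>x. exp (l x)) differentiable (at x)" for x
    using differentiable_chain_at[OF polynomial_fun_differentiable[OF l, of x]
      field_differentiable_imp_differentiable[OF field_differentiable_within_exp]]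
    by (simp add: o_def)
  have "iterated_partial is (\<lambda>x. exp (l x)) differentiable (at x)" for "is" x
    using ip[of "is"] exp_l polynomial_fun_differentiable
    by (auto intro!: differentiable_mult)
  moreover have "bounded (range (\<lambda>x. (1 + norm x) ^ k *\<^sub>R iterated_partial is (\<lambda>x. exp (l x)) x))" for "is" k
  proof -
    obtain q where q: "q \<in> polynomial_fun" "iterated_partial is (\<lambda>x. exp (l x)) = (\<lambda>x. q x * exp (l x))"
      using ip by blast
    obtain C m where C: "\<And>x. norm (q x) \<le> C * (1 + norm x) ^ m"
      using polynomial_fun_growth[OF q(1)] by blast
    define n where "n = real (k + m)"
    have "norm ((1 + norm x) ^ k *\<^sub>R (q x * exp (l x))) \<le> \<bar>C\<bar> * exp (n\<^sup>2 / (4 * a))" for x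
    proof -
      have "(1 + norm x) ^ (k + m) \<le> exp (norm x) ^ (k + m)"
        by (intro power_mono) (auto intro: exp_ge_add_one_self)
      also have "\<dots> = exp (n * norm x)" by (simp add: n_def flip: exp_of_nat_mult)
      finally have 1: "(1 + norm x) ^ (k + m) \<le> exp (n * norm x)" .
      have "0 \<le> (2 * a * norm x - n)\<^sup>2 / (4 * a)" using a by simp
      also have "\<dots> = n\<^sup>2 / (4 * a) - n * norm x + a * (norm x)\<^sup>2"
        using a by (simp add: power2_eq_square field_simps)
      finally have 2: "n * norm x + Re (l x) \<le> n\<^sup>2 / (4 * a)" using Re[of x] by linarith
      have "norm ((1 + norm x) ^ k *\<^sub>R (q x * exp (l x))) = (1 + norm x) ^ k * norm (q x) * exp (Re (l x))"
        by (simp add: norm_mult)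
      also have "\<dots> \<le> (1 + norm x) ^ k * (\<bar>C\<bar> * (1 + norm x) ^ m) * exp (Re (l x))"
        by (intro mult_right_mono mult_left_mono order_trans[OF C]) auto
      also have "\<dots> = \<bar>C\<bar> * ((1 + norm x) ^ (k + m) * exp (Re (l x)))"
        by (simp add: power_add mult_ac)
      also have "\<dots> \<le> \<bar>C\<bar> * (exp (n * norm x) * exp (Re (l x)))"
        using 1 by (intro mult_left_mono mult_right_mono) auto
      also have "\<dots> \<le> \<bar>C\<bar> * exp (n\<^sup>2 / (4 * a))"
        using 2 by (intro mult_left_mono) (auto simp flip: exp_add)
      finally show ?thesis .
    qed
    then show ?thesis unfolding q(2) by (auto simp: bounded_iff)
  qed
  ultimately show ?thesis unfolding schwartz_space_def by blast
qed

text \<open>This is the characteristic function of the standard normal distribution after the substitution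
\<open>z = e t\<close>.\<close>

lemma gaussian_fourier_1d:
  fixes e u :: real
  assumes e: "e > 0"
  shows "integrable lborel (\<lambda>t. exp (complex_of_real (- (e * t)\<^sup>2 / 2) + \<i> * complex_of_real (u * t)))" (is ?int)
    and "(LINT t|lborel. exp (complex_of_real (- (e * t)\<^sup>2 / 2) + \<i> * complex_of_real (u * t))) =
      complex_of_real (2 * pi / e * std_normal_density (u / e))" (is ?eq)
proof -
  let ?f = "\<lambda>z. complex_of_real (sqrt (2 * pi) * std_normal_density z) * iexp (u / e * z)"
  have intf: "integrable lborel ?f"
    by (rule Bochner_Integration.integrable_bound[of _ "\<lambda>z. sqrt (2 * pi) * std_normal_density z"])
      (auto simp: norm_mult)
  have "(LINT z|lborel. ?f z) = complex_of_real (sqrt (2 * pi)) * (LINT z|lborel. std_normal_density z *\<^sub>R iexp (u / e * z))"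
    unfolding integral_mult_right_zero[symmetric]
    by (intro Bochner_Integration.integral_cong refl) (simp add: scaleR_conv_of_real mult.assoc)
  also have "(LINT z|lborel. std_normal_density z *\<^sub>R iexp (u / e * z)) = char std_normal_distribution (u / e)"
    unfolding char_def by (subst integral_density) auto
  also have "\<dots> = complex_of_real (exp (- (u / e)\<^sup>2 / 2))"
    by (simp add: char_std_normal_distribution)
  also have "complex_of_real (sqrt (2 * pi)) * \<dots> = complex_of_real (2 * pi * std_normal_density (u / e))"
    by (simp add: std_normal_density_def real_div_sqrt field_simps flip: of_real_mult)
  finally have f: "(LINT z|lborel. ?f z) = complex_of_real (2 * pi * std_normal_density (u / e))" .
  have eq: "?f (0 + e * t) = exp (complex_of_real (- (e * t)\<^sup>2 / 2) + \<i> * complex_of_real (u * t))" for t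
    using e by (simp add: std_normal_density_def mult_exp_exp flip: exp_of_real)
  have "integrable lborel (\<lambda>t. ?f (0 + e * t))"
    by (rule lborel_integrable_real_affine[OF intf]) (use e in simp)
  then show ?int by (simp only: eq)
  have "(LINT z|lborel. ?f z) = \<bar>e\<bar> *\<^sub>R (LINT t|lborel. ?f (0 + e * t))"
    by (rule lborel_integral_real_affine) (use e in simp)
  then have "complex_of_real (2 * pi * std_normal_density (u / e)) =
      e *\<^sub>R (LINT t|lborel. exp (complex_of_real (- (e * t)\<^sup>2 / 2) + \<i> * complex_of_real (u * t)))"
    unfolding f eq[symmetric] using e by simp
  then show ?eq using e by (simp add: scaleR_conv_of_real field_simps)
qed

text \<open>The Gaussian \<open>exp (- e\<^sup>2 |\<xi>|\<^sup>2 / 2)\<close> times the character \<open>exp (2 \<pi> i \<xi> \<bullet> x)\<close>, written as the exponential of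
a polynomial that splits into coordinates: the first makes it a Schwartz function, the second
reduces its transform to one variable.\<close>

definition modulated_gaussian :: "real \<Rightarrow> real ^ 'd \<Rightarrow> real ^ 'd \<Rightarrow> complex" where
  "modulated_gaussian e x \<xi> =
     exp (\<Sum>i\<in>UNIV. complex_of_real (- (e * \<xi> $ i)\<^sup>2 / 2) + \<i> * complex_of_real (2 * pi * x $ i * \<xi> $ i))"

lemma modulated_gaussian_eq:
  "modulated_gaussian e x \<xi> =
     complex_of_real (exp (- (e * norm \<xi>)\<^sup>2 / 2)) * exp (\<i> * complex_of_real (2 * pi * (\<xi> \<bullet> x)))"
proof -
  have n: "(norm \<xi>)\<^sup>2 = (\<Sum>i\<in>UNIV. (\<xi> $ i)\<^sup>2)"
    unfolding power2_norm_eq_inner inner_vec_def by (simp add: power2_eq_square)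
  have i: "\<xi> \<bullet> x = (\<Sum>i\<in>UNIV. x $ i * \<xi> $ i)" by (simp add: inner_vec_def mult.commute)
  have "(\<Sum>i\<in>UNIV. complex_of_real (- (e * \<xi> $ i)\<^sup>2 / 2) + \<i> * complex_of_real (2 * pi * x $ i * \<xi> $ i)) =
      complex_of_real (- (e * norm \<xi>)\<^sup>2 / 2) + \<i> * complex_of_real (2 * pi * (\<xi> \<bullet> x))"
    unfolding power_mult_distrib n i
    by (simp add: sum_subtractf sum_distrib_left sum_divide_distrib mult_ac)
  then show ?thesis unfolding modulated_gaussian_def by (simp only: exp_add exp_of_real)
qed

lemma modulated_gaussian_schwartz:
  fixes x :: "real ^ 'd"
  assumes e: "e > 0"
  shows "modulated_gaussian e x \<in> schwartz_space"
proof -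
  let ?l = "\<lambda>\<xi> :: real ^ 'd. \<Sum>i\<in>UNIV. complex_of_real (- (e * \<xi> $ i)\<^sup>2 / 2) + \<i> * complex_of_real (2 * pi * x $ i * \<xi> $ i)"
  have "(\<lambda>\<xi>. exp (?l \<xi>)) \<in> schwartz_space"
  proof (rule exp_polynomial_schwartz)
    have "?l = (\<lambda>\<xi>. \<Sum>i\<in>UNIV. complex_of_real (- e\<^sup>2 / 2) * (complex_of_real (\<xi> $ i) * complex_of_real (\<xi> $ i))
        + (\<i> * complex_of_real (2 * pi * x $ i)) * complex_of_real (\<xi> $ i))"
      by (intro ext sum.cong refl) (simp add: power2_eq_square)
    also have "\<dots> \<in> polynomial_fun"
      by (intro polynomial_fun_sum polynomial_fun.intros)
    finally show "?l \<in> polynomial_fun" .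
    show "e\<^sup>2 / 2 > 0" using e by simp
    fix \<xi> :: "real ^ 'd"
    have n: "(norm \<xi>)\<^sup>2 = (\<Sum>i\<in>UNIV. (\<xi> $ i)\<^sup>2)"
      unfolding power2_norm_eq_inner inner_vec_def by (simp add: power2_eq_square)
    show "Re (?l \<xi>) \<le> - (e\<^sup>2 / 2) * (norm \<xi>)\<^sup>2"
      unfolding n by (simp add: sum_distrib_left power_mult_distrib sum_negf sum_divide_distrib)
  qed
  then show ?thesis by (simp add: modulated_gaussian_def[abs_def])
qed

lemma fourier_modulated_gaussian:
  fixes x y :: "real ^ 'd"
  assumes e: "e > 0"
  shows "fourier (modulated_gaussian e x) y =
    complex_of_real (\<Prod>i\<in>UNIV. 2 * pi / e * std_normal_density (2 * pi * (x $ i - y $ i) / e))"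
proof -
  let ?h = "\<lambda>i t. exp (complex_of_real (- (e * t)\<^sup>2 / 2) + \<i> * complex_of_real (2 * pi * (x $ i - y $ i) * t))"
  have "modulated_gaussian e x \<xi> * exp (- \<i> * complex_of_real (2 * pi * (y \<bullet> \<xi>))) = (\<Prod>i\<in>UNIV. ?h i (\<xi> $ i))" for \<xi>
  proof -
    have "- \<i> * complex_of_real (2 * pi * (y \<bullet> \<xi>)) = (\<Sum>i\<in>UNIV. - \<i> * complex_of_real (2 * pi * (y $ i * \<xi> $ i)))"
      by (simp add: inner_vec_def sum_distrib_left)
    then show ?thesis
      unfolding modulated_gaussian_def exp_sum[OF finite, symmetric] exp_add[symmetric]
      by (simp only: sum.distrib[symmetric]) (intro arg_cong[of _ _ exp] sum.cong refl, simp add: algebra_simps)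
  qed
  then have "fourier (modulated_gaussian e x) y = (LINT \<xi>|lborel. (\<Prod>i\<in>UNIV. ?h i (\<xi> $ i)))"
    unfolding fourier_def by simp
  also have "\<dots> = (\<Prod>i\<in>UNIV. LINT t|lborel. ?h i t)"
    by (rule integral_lborel_prod_vec) (rule gaussian_fourier_1d(1)[OF e])
  also have "\<dots> = (\<Prod>i\<in>UNIV. complex_of_real (2 * pi / e * std_normal_density (2 * pi * (x $ i - y $ i) / e)))"
    using gaussian_fourier_1d(2)[OF e] by (intro prod.cong refl)
  finally show ?thesis by simp
qed

lemma integral_lborel_affine:
  fixes f :: "'a::euclidean_space \<Rightarrow> 'b::{banach,second_countable_topology}"
  assumes c: "c \<noteq> 0" and [measurable]: "f \<in> borel_measurable borel"
  shows "(LINT x|lborel. f x) = \<bar>c\<bar> ^ DIM('a) *\<^sub>R (LINT x|lborel. f (t + c *\<^sub>R x))"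
proof -
  have "(LINT x|lborel. f x) = (LINT x|density (distr lborel borel (\<lambda>x. t + c *\<^sub>R x)) (\<lambda>_. \<bar>c\<bar> ^ DIM('a)). f x)"
    using lborel_affine[OF c, of t] by simp
  also have "\<dots> = \<bar>c\<bar> ^ DIM('a) *\<^sub>R (LINT x|lborel. f (t + c *\<^sub>R x))"
    by (subst integral_density) (simp_all add: integral_distr)
  finally show ?thesis .
qed

text \<open>The transform of the test function is a normal density centred at \<open>x\<close> with standard deviation
\<open>e / (2 \<pi>)\<close> in each coordinate, so integrating \<open>u\<close> against it averages \<open>u\<close> over points near \<open>x\<close>.\<close>

lemma integral_fourier_modulated_gaussian:
  fixes u :: "real ^ 'd \<Rightarrow> complex"
  assumes e: "e > 0" and [measurable]: "u \<in> borel_measurable borel"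
  shows "(LINT y|lborel. u y * fourier (modulated_gaussian e x) y) =
    (LINT z|lborel. u (x + (e / (2 * pi)) *\<^sub>R z) * complex_of_real (\<Prod>i\<in>UNIV. std_normal_density (z $ i)))"
proof -
  define c where "c = e / (2 * pi)"
  have c: "c > 0" using e by (simp add: c_def)
  have F: "fourier (modulated_gaussian e x) y =
      complex_of_real ((1 / c) ^ CARD('d) * (\<Prod>i\<in>UNIV. std_normal_density ((x $ i - y $ i) / c)))" for y
    unfolding fourier_modulated_gaussian[OF e] by (simp add: prod.distrib c_def mult.commute prod_dividef power_divide)
  have "(LINT y|lborel. u y * fourier (modulated_gaussian e x) y) =
     \<bar>c\<bar> ^ DIM(real ^ 'd) *\<^sub>R (LINT z|lborel. u (x + c *\<^sub>R z) * fourier (modulated_gaussian e x) (x + c *\<^sub>R z))"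
    unfolding F using c by (intro integral_lborel_affine) auto
  also have "\<dots> = (LINT z|lborel. \<bar>c\<bar> ^ DIM(real ^ 'd) *\<^sub>R (u (x + c *\<^sub>R z) * fourier (modulated_gaussian e x) (x + c *\<^sub>R z)))"
    by simp
  also have "\<dots> = (LINT z|lborel. u (x + c *\<^sub>R z) * complex_of_real (\<Prod>i\<in>UNIV. std_normal_density (z $ i)))"
    using c unfolding F
    by (intro Bochner_Integration.integral_cong refl)
      (simp add: scaleR_conv_of_real[where 'a=complex] power_divide, simp add: std_normal_density_def)
  finally show ?thesis by (simp add: c_def)
qed

section \<open>Fourier inversion\<close>

text \<open>Test the identity of distributions with modulated Gaussians and let their parameter \<open>e\<close> tend to zero. On one side the averages of \<open>u\<close> converge to \<open>u x\<close> by continuity, on the other the Gaussian factor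
tends to one. Both limits are dominated, by a multiple of the normal density and by \<open>|g|\<close>.\<close>

lemma fourier_inversion:
  fixes u g :: "real ^ 'd \<Rightarrow> complex"
  assumes u: "continuous_on UNIV u" "bounded (range u)"
    and ft: "has_fourier_transform u g" and g: "integrable lborel g"
  shows "u x = (LINT \<xi>|lborel. g \<xi> * exp (\<i> * complex_of_real (2 * pi * (\<xi> \<bullet> x))))"
proof -
  \<comment> \<open>Any positive null sequence serves; the test functions flatten while their transforms concentrate.\<close>
  define e where "e n = inverse (real (Suc n))" for n
  have e: "e n > 0" for n by (simp add: e_def)
  have e0: "e \<longlonglongrightarrow> 0" unfolding e_def by (rule LIMSEQ_inverse_real_of_nat)
  have [measurable]: "u \<in> borel_measurable borel" using u(1) by (rule borel_measurable_continuous_onI)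
  have [measurable]: "g \<in> borel_measurable borel" using borel_measurable_integrable[OF g] by simp
  obtain B where B: "\<And>x. norm (u x) \<le> B" using u(2) by (auto simp: bounded_iff)
  let ?N = "\<lambda>z::real ^ 'd. \<Prod>i\<in>UNIV. std_normal_density (z $ i)"
  have N: "integrable lborel ?N" by (rule integrable_lborel_prod_vec) simp
  have N1: "(LINT z|lborel. complex_of_real (?N z)) = 1"
    using integral_lborel_prod_vec[of "\<lambda>(_::'d). std_normal_density"]
    by (subst integral_complex_of_real) simp
  have N0: "0 \<le> ?N z" for z by (intro prod_nonneg) simp
  have "(\<lambda>n. LINT y|lborel. u y * fourier (modulated_gaussian (e n) x) y) \<longlonglongrightarrow>
      (LINT z|lborel. u x * complex_of_real (?N z))"
    unfolding integral_fourier_modulated_gaussian[OF e \<open>u \<in> borel_measurable borel\<close>]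
  proof (rule integral_dominated_convergence[where w="\<lambda>z. B * ?N z"])
    show "integrable lborel (\<lambda>z. B * ?N z)" using N by simp
    have "(\<lambda>n. u (x + (e n / (2 * pi)) *\<^sub>R z)) \<longlonglongrightarrow> u x" for z
    proof -
      have "(\<lambda>n. x + (e n / (2 * pi)) *\<^sub>R z) \<longlonglongrightarrow> x + (0 / (2 * pi)) *\<^sub>R z"
        by (intro tendsto_intros e0) simp
      then have "(\<lambda>n. x + (e n / (2 * pi)) *\<^sub>R z) \<longlonglongrightarrow> x" by simp
      then show ?thesis using u(1) by (auto simp: continuous_on_eq_continuous_at intro: isCont_tendsto_compose)
    qed
    then show "AE z in lborel. (\<lambda>n. u (x + (e n / (2 * pi)) *\<^sub>R z) * complex_of_real (?N z))
        \<longlonglongrightarrow> u x * complex_of_real (?N z)"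
      by (intro AE_I2 tendsto_mult_right)
    show "AE z in lborel. norm (u (x + (e n / (2 * pi)) *\<^sub>R z) * complex_of_real (?N z)) \<le> B * ?N z" for n
      using B N0 by (intro AE_I2) (simp add: norm_mult mult_right_mono del: of_real_prod)
  qed measurable
  also have "(LINT z|lborel. u x * complex_of_real (?N z)) = u x"
    using N1 by simp
  finally have lim1: "(\<lambda>n. LINT y|lborel. u y * fourier (modulated_gaussian (e n) x) y) \<longlonglongrightarrow> u x" .
  have "(LINT y|lborel. u y * fourier (modulated_gaussian (e n) x) y) =
      (LINT \<xi>|lborel. g \<xi> * modulated_gaussian (e n) x \<xi>)" for n
    using ft modulated_gaussian_schwartz[OF e, of n x]
    unfolding has_fourier_transform_def distribution_fourier_def regular_distribution_def by blast
  moreover have "(\<lambda>n. LINT \<xi>|lborel. g \<xi> * modulated_gaussian (e n) x \<xi>) \<longlonglongrightarrow>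
      (LINT \<xi>|lborel. g \<xi> * exp (\<i> * complex_of_real (2 * pi * (\<xi> \<bullet> x))))"
    unfolding modulated_gaussian_eq
  proof (rule integral_dominated_convergence[where w="\<lambda>\<xi>. norm (g \<xi>)"])
    show "integrable lborel (\<lambda>\<xi>. norm (g \<xi>))" using g by simp
    have "(\<lambda>n. complex_of_real (exp (- (e n * norm \<xi>)\<^sup>2 / 2))) \<longlonglongrightarrow> complex_of_real (exp (- (0 * norm \<xi>)\<^sup>2 / 2))"
      for \<xi> :: "real ^ 'd"
      by (intro tendsto_intros e0) simp
    then have "(\<lambda>n. g \<xi> * (complex_of_real (exp (- (e n * norm \<xi>)\<^sup>2 / 2)) * exp (\<i> * complex_of_real (2 * pi * (\<xi> \<bullet> x)))))
      \<longlonglongrightarrow> g \<xi> * (1 * exp (\<i> * complex_of_real (2 * pi * (\<xi> \<bullet> x))))" for \<xi>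
      by (intro tendsto_mult tendsto_const) simp
    then show "AE \<xi> in lborel. (\<lambda>n. g \<xi> * (complex_of_real (exp (- (e n * norm \<xi>)\<^sup>2 / 2)) * exp (\<i> * complex_of_real (2 * pi * (\<xi> \<bullet> x)))))
      \<longlonglongrightarrow> g \<xi> * exp (\<i> * complex_of_real (2 * pi * (\<xi> \<bullet> x)))" by simp
    show "AE \<xi> in lborel. norm (g \<xi> * (complex_of_real (exp (- (e n * norm \<xi>)\<^sup>2 / 2)) * exp (\<i> * complex_of_real (2 * pi * (\<xi> \<bullet> x))))) \<le> norm (g \<xi>)" for n
      by (intro AE_I2) (simp add: norm_mult mult_left_le)
  qed measurable
  ultimately show ?thesis using lim1 LIMSEQ_unique by simp
qed

section \<open>A cutoff function with decaying Fourier transform\<close>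

lemma (in pair_sigma_finite) integrable_pair_bounded:
  fixes f :: "'a \<Rightarrow> complex" and g :: "'b \<Rightarrow> complex" and h :: "'a \<times> 'b \<Rightarrow> complex"
  assumes f: "integrable M1 f" and g: "integrable M2 g"
    and h: "h \<in> borel_measurable (M1 \<Otimes>\<^sub>M M2)"
    and le: "\<And>x y. norm (h (x, y)) \<le> norm (f x) * norm (g y)"
  shows "integrable (M1 \<Otimes>\<^sub>M M2) h"
proof (rule Bochner_Integration.integrable_bound)
  note [measurable] = borel_measurable_integrable[OF f] borel_measurable_integrable[OF g]
  show "integrable (M1 \<Otimes>\<^sub>M M2) (\<lambda>p. f (fst p) * g (snd p))"
    by (rule Fubini_integrable) (use f g in \<open>auto simp: norm_mult\<close>)
  show "AE p in M1 \<Otimes>\<^sub>M M2. norm (h p) \<le> norm (f (fst p) * g (snd p))"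
    using le by (intro AE_I2) (auto simp: norm_mult)
qed (rule h)

text \<open>The one-dimensional counterpart of \<^const>\<open>fourier\<close>, from which the transform of the cutoff is built
coordinate by coordinate.\<close>

definition fourier_line :: "(real \<Rightarrow> complex) \<Rightarrow> real \<Rightarrow> complex" where
  "fourier_line u \<xi> = (LINT t|lborel. u t * exp (- \<i> * complex_of_real (2 * pi * (\<xi> * t))))"

lemma norm_exp_imag: "norm (exp (- \<i> * complex_of_real r)) = 1" "norm (exp (\<i> * complex_of_real r)) = 1"
  by simp_all

lemma integrable_times_bounded:
  fixes f g :: "'a \<Rightarrow> complex"
  assumes "integrable M f" "g \<in> borel_measurable M" "\<And>x. norm (g x) \<le> 1"
  shows "integrable M (\<lambda>x. f x * g x)"
  by (rule Bochner_Integration.integrable_bound[OF assms(1)])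
    (use assms in \<open>auto simp: norm_mult mult_left_le\<close>)

lemma norm_fourier_line_le:
  assumes "integrable lborel u"
  shows "norm (fourier_line u \<xi>) \<le> (LINT t|lborel. norm (u t))"
  unfolding fourier_line_def
  by (rule order_trans[OF integral_norm_bound]) (simp add: norm_mult)

lemma integrable_indicator_interval: "integrable lborel (indicator {a..b::real} :: real \<Rightarrow> real)"
    "integrable lborel (indicator {a..b} :: real \<Rightarrow> complex)"
proof -
  show *: "integrable lborel (indicator {a..b} :: real \<Rightarrow> real)"
    by (intro integrable_real_indicator) (auto simp: emeasure_lborel_Icc_eq)
  have "integrable lborel (\<lambda>t. complex_of_real (indicator {a..b} t))" using * by (rule integrable_of_real)
  also have "(\<lambda>t. complex_of_real (indicator {a..b} t)) = indicator {a..b}"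
    by (auto split: split_indicator)
  finally show "integrable lborel (indicator {a..b} :: real \<Rightarrow> complex)" .
qed

text \<open>For small \<open>\<xi>\<close> the bound follows from the length of the interval, for large \<open>\<xi>\<close> it comes from the explicit
antiderivative.\<close>

lemma fourier_line_interval_bound:
  "norm (fourier_line (indicator {0..1}) \<xi>) \<le> 2 / (1 + \<bar>\<xi>\<bar>)"
proof (cases "\<bar>\<xi>\<bar> \<le> 1")
  case True
  have "norm (fourier_line (indicator {0..1}) \<xi>) \<le> (LINT t|lborel. norm (indicator {0..1::real} t :: complex))"
    by (rule norm_fourier_line_le) (rule integrable_indicator_interval(2))
  also have "\<dots> = (LINT t|lborel. indicator {0..1::real} t)"
    by (intro Bochner_Integration.integral_cong refl) (auto split: split_indicator)
  also have "\<dots> = 1" by simp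
  also have "\<dots> \<le> 2 / (1 + \<bar>\<xi>\<bar>)" using True by simp
  finally show ?thesis .
next
  case False
  then have \<xi>: "\<xi> \<noteq> 0" by auto
  define k where "k = - \<i> * complex_of_real (2 * pi * \<xi>)"
  have k: "k \<noteq> 0" "norm k = 2 * pi * \<bar>\<xi>\<bar>" using \<xi> by (auto simp: k_def norm_mult)
  have "has_bochner_integral lborel (\<lambda>t. indicator {0..1} t *\<^sub>R exp (k * complex_of_real t))
      (exp (k * complex_of_real 1) / k - exp (k * complex_of_real 0) / k)"
  proof (rule has_bochner_integral_FTC_Icc)
    fix t :: real
    have "((\<lambda>z. exp (k * z) / k) has_field_derivative exp (k * complex_of_real t)) (at (complex_of_real t))"
      using k by (auto intro!: derivative_eq_intros)
    then show "((\<lambda>t. exp (k * complex_of_real t) / k) has_vector_derivative exp (k * complex_of_real t)) (at t within {0..1})"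
      by (rule has_vector_derivative_real_field)
  qed (auto intro!: continuous_intros)
  then have "(LINT t|lborel. indicator {0..1} t *\<^sub>R exp (k * complex_of_real t)) = (exp k - 1) / k"
    by (auto dest!: has_bochner_integral_integral_eq simp: diff_divide_distrib)
  moreover have "(LINT t|lborel. indicator {0..1} t *\<^sub>R exp (k * complex_of_real t)) = fourier_line (indicator {0..1}) \<xi>"
    unfolding fourier_line_def
    by (intro Bochner_Integration.integral_cong refl) (auto simp: k_def mult_ac split: split_indicator)
  ultimately have "norm (fourier_line (indicator {0..1}) \<xi>) = norm (exp k - 1) / norm k"
    by (simp add: norm_divide)
  also have "\<dots> \<le> 2 / norm k"
  proof (intro divide_right_mono)
    show "norm (exp k - 1) \<le> 2"
      using norm_triangle_ineq4[of "exp k" 1] norm_exp_imag(1)[of "2 * pi * \<xi>"] unfolding k_def by simp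
  qed simp
  also have "\<dots> \<le> 2 / (1 + \<bar>\<xi>\<bar>)"
  proof -
    have "1 + \<bar>\<xi>\<bar> \<le> 2 * \<bar>\<xi>\<bar>" using False by simp
    also have "\<dots> \<le> norm k" unfolding k using pi_ge_two by (intro mult_right_mono) auto
    moreover have "0 < norm k" using k(1) by simp
    ultimately show ?thesis by (intro divide_left_mono mult_pos_pos) auto
  qed
  finally show ?thesis .
qed

text \<open>Convolution with the indicator of the unit interval: it multiplies the transform by a factor of
order \<open>1 / |\<xi>|\<close> and keeps the value one on an interval that becomes shorter by one.\<close>

definition moving_average :: "(real \<Rightarrow> complex) \<Rightarrow> real \<Rightarrow> complex" where
  "moving_average u t = (LINT r|lborel. indicator {0..1} r * u (t - r))"

lemma integral_lborel_shift:
  fixes f :: "'a::euclidean_space \<Rightarrow> 'b::{banach,second_countable_topology}"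
  assumes [measurable]: "f \<in> borel_measurable borel"
  shows "(LINT x|lborel. f (x - c)) = (LINT x|lborel. f x)"
  using integral_lborel_affine[of 1 f "- c"] by simp

lemma integrable_lborel_shift:
  fixes f :: "'a::euclidean_space \<Rightarrow> 'b::{banach,second_countable_topology}"
  assumes f: "integrable lborel f"
  shows "integrable lborel (\<lambda>x. f (x - c))"
proof -
  have "integrable (distr lborel borel ((+) (- c))) f"
    using f by (simp add: lborel_distr_plus)
  then show ?thesis by (subst (asm) integrable_distr_eq) (use f in auto)
qed

text \<open>Fubini is needed twice for this integrand, with \<open>h = 1\<close> for integrability and with \<open>h\<close> a character for
the transform.\<close>

lemma moving_average_integrable_pair:
  fixes u h :: "real \<Rightarrow> complex"
  assumes u: "integrable lborel u" and h[measurable]: "h \<in> borel_measurable borel"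
    and h1: "\<And>t. norm (h t) \<le> 1"
  shows "integrable (lborel \<Otimes>\<^sub>M lborel) (\<lambda>(r::real, t). indicator {0..1} r * u (t - r) * h t)"
proof (rule lborel_pair.Fubini_integrable)
  have [measurable]: "u \<in> borel_measurable borel" using borel_measurable_integrable[OF u] by simp
  show "(\<lambda>(r::real, t). indicator {0..1} r * u (t - r) * h t) \<in> borel_measurable (lborel \<Otimes>\<^sub>M lborel)"
    by measurable
  have int: "integrable lborel (\<lambda>t. u (t - r) * h t)" for r
    by (rule integrable_times_bounded[OF integrable_lborel_shift[OF u]]) (use h1 in auto)
  then show "AE r in lborel. integrable lborel (\<lambda>t. case (r, t) of (r, t) \<Rightarrow> indicator {0..1} r * u (t - r) * h t)"
    by (auto simp: mult.assoc)
  show "integrable lborel (\<lambda>r. LINT t|lborel. norm (case (r, t) of (r, t) \<Rightarrow> indicator {0..1::real} r * u (t - r) * h t))"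
  proof (rule Bochner_Integration.integrable_bound)
    show "integrable lborel (\<lambda>r. indicator {0..1::real} r * (LINT t|lborel. norm (u t)))"
      by (rule integrable_mult_left[OF integrable_indicator_interval(1)])
    show "AE r in lborel. norm (LINT t|lborel. norm (case (r, t) of (r, t) \<Rightarrow> indicator {0..1::real} r * u (t - r) * h t))
      \<le> norm (indicator {0..1::real} r * (LINT t|lborel. norm (u t)))"
    proof (intro AE_I2)
      fix r :: real
      have "(LINT t|lborel. norm (u (t - r) * h t)) \<le> (LINT t|lborel. norm (u (t - r)))"
        using integrable_norm[OF int[of r]] integrable_norm[OF integrable_lborel_shift[OF u, of r]] h1
        by (intro integral_mono) (auto simp: norm_mult mult_left_le)
      also have "\<dots> = (LINT t|lborel. norm (u t))"
        by (rule integral_lborel_shift) measurable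
      finally show "norm (LINT t|lborel. norm (case (r, t) of (r, t) \<Rightarrow> indicator {0..1::real} r * u (t - r) * h t))
        \<le> norm (indicator {0..1::real} r * (LINT t|lborel. norm (u t)))"
        by (auto split: split_indicator)
    qed
  qed measurable
qed

lemma moving_average_integrable:
  assumes u: "integrable lborel u"
  shows "integrable lborel (moving_average u)"
  using lborel_pair.integrable_snd[OF moving_average_integrable_pair[OF u, of "\<lambda>_. 1"]]
  by (simp add: moving_average_def[abs_def])

lemma fourier_line_moving_average:
  assumes u: "integrable lborel u"
  shows "fourier_line (moving_average u) \<xi> = fourier_line (indicator {0..1}) \<xi> * fourier_line u \<xi>"
proof -
  have [measurable]: "u \<in> borel_measurable borel" using borel_measurable_integrable[OF u] by simp
  let ?e = "\<lambda>t. exp (- \<i> * complex_of_real (2 * pi * (\<xi> * t)))"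
  have "fourier_line (moving_average u) \<xi> = (LINT t|lborel. LINT r|lborel. indicator {0..1} r * u (t - r) * ?e t)"
    unfolding fourier_line_def moving_average_def by simp
  also have "\<dots> = (LINT r|lborel. LINT t|lborel. indicator {0..1} r * u (t - r) * ?e t)"
    by (rule lborel_pair.Fubini_integral) (rule moving_average_integrable_pair[OF u], auto)
  also have "\<dots> = (LINT r|lborel. indicator {0..1} r * ?e r * fourier_line u \<xi>)"
  proof (intro Bochner_Integration.integral_cong refl)
    fix r :: real
    \<comment> \<open>The character is multiplicative: \<open>exp (- 2 \<pi> i \<xi> t)\<close> splits at \<open>t = r + (t - r)\<close>.\<close>
    have "(LINT t|lborel. indicator {0..1} r * u (t - r) * ?e t) =
        (LINT t|lborel. (\<lambda>t. indicator {0..1} r * ?e r * (u t * ?e t)) (t - r))"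
      by (intro Bochner_Integration.integral_cong refl)
        (simp add: mult_exp_exp algebra_simps)
    also have "\<dots> = (LINT t|lborel. indicator {0..1} r * ?e r * (u t * ?e t))"
      by (rule integral_lborel_shift) measurable
    also have "\<dots> = indicator {0..1} r * ?e r * fourier_line u \<xi>"
      unfolding fourier_line_def by (rule integral_mult_right_zero)
    finally show "(LINT t|lborel. indicator {0..1} r * u (t - r) * ?e t) = indicator {0..1} r * ?e r * fourier_line u \<xi>" .
  qed
  also have "\<dots> = fourier_line (indicator {0..1}) \<xi> * fourier_line u \<xi>"
    unfolding fourier_line_def[of "indicator {0..1}"] by (rule integral_mult_left_zero)
  finally show ?thesis .
qed

text \<open>For almost every \<open>r\<close> the point \<open>t - r\<close> is not an end point of the interval, so that the indicator is
continuous there and dominated convergence applies.\<close>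

lemma moving_average_continuous:
  assumes u: "integrable lborel u"
  shows "continuous_on UNIV (moving_average u)"
proof -
  have [measurable]: "u \<in> borel_measurable borel" using borel_measurable_integrable[OF u] by simp
  have eq: "moving_average u t = (LINT r|lborel. indicator {0..1} (t - r) *\<^sub>R u r)" for t
    unfolding moving_average_def
    by (subst lborel_integral_real_affine[where c="-1" and t=t])
      (auto intro!: Bochner_Integration.integral_cong split: split_indicator)
  have "(\<lambda>n. moving_average u (X n)) \<longlonglongrightarrow> moving_average u t" if X: "X \<longlonglongrightarrow> t" for X t
    unfolding eq
  proof (rule integral_dominated_convergence[where w="\<lambda>r. norm (u r)"])
    show "integrable lborel (\<lambda>r. norm (u r))" using u by simp
    show "AE r in lborel. (\<lambda>n. indicator {0..1} (X n - r) *\<^sub>R u r) \<longlonglongrightarrow> indicator {0..1} (t - r) *\<^sub>R u r"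
      using AE_lborel_singleton[of t] AE_lborel_singleton[of "t - 1"]
    proof eventually_elim
      case (elim r)
      then have "t - r \<notin> frontier {0..1}" by (auto simp: frontier_def)
      then have "isCont (indicator {0..1} ::  real \<Rightarrow> real) (t - r)" by (simp add: isCont_indicator)
      moreover have "(\<lambda>n. X n - r) \<longlonglongrightarrow> t - r" using X by (intro tendsto_intros)
      ultimately have "(\<lambda>n. indicator {0..1} (X n - r) :: real) \<longlonglongrightarrow> indicator {0..1} (t - r)"
        by (rule isCont_tendsto_compose)
      then show ?case by (intro tendsto_scaleR tendsto_const)
    qed
    show "AE r in lborel. norm (indicator {0..1} (X n - r) *\<^sub>R u r) \<le> norm (u r)" for n
      by (auto split: split_indicator)
  qed measurable
  then show ?thesis
    by (auto simp: continuous_on_eq_continuous_at continuous_at_sequentially o_def)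
qed

text \<open>Each averaging gains one order of decay. It spoils the plateau within distance one of its left end,
so the induction starts from a plateau that is longer by one.\<close>

lemma cutoff_line:
  "\<exists>u. integrable lborel u \<and> (\<forall>t. norm (u t) \<le> 1) \<and> (\<forall>t\<in>{a..b}. u t = 1) \<and>
     (n > 0 \<longrightarrow> continuous_on UNIV u) \<and> (\<exists>C. \<forall>\<xi>. norm (fourier_line u \<xi>) \<le> C / (1 + \<bar>\<xi>\<bar>) ^ n)"
proof (induction n arbitrary: a b)
  case 0
  note int = integrable_indicator_interval(2)[of a b]
  show ?case
    by (intro exI[of _ "indicator {a..b}"] conjI int exI[of _ "LINT t|lborel. norm (indicator {a..b} t :: complex)"])
      (use norm_fourier_line_le[OF int] in \<open>auto split: split_indicator\<close>)
next
  case (Suc n)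
  from Suc[of "a - 1" b] obtain u C where u: "integrable lborel u" "\<And>t. norm (u t) \<le> 1" "\<And>t. t \<in> {a - 1..b} \<Longrightarrow> u t = 1"
    and C: "\<And>\<xi>. norm (fourier_line u \<xi>) \<le> C / (1 + \<bar>\<xi>\<bar>) ^ n" by blast
  have [measurable]: "u \<in> borel_measurable borel" using borel_measurable_integrable[OF u(1)] by simp
  have one: "(LINT r|lborel. indicator {0..1::real} r :: complex) = 1"
  proof -
    have "(LINT r|lborel. indicator {0..1::real} r :: complex) = (LINT r|lborel. indicator {0..1::real} r *\<^sub>R 1)"
      by (intro Bochner_Integration.integral_cong refl) (auto split: split_indicator)
    then show ?thesis by simp
  qed
  have le1: "norm (moving_average u t) \<le> 1" for t
  proof -
    have "norm (moving_average u t) \<le> (LINT r|lborel. norm (indicator {0..1} r * u (t - r)))"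
      unfolding moving_average_def by (rule integral_norm_bound)
    also have "\<dots> \<le> (LINT r|lborel. indicator {0..1::real} r)"
      using u(2) by (intro integral_mono' ) (auto split: split_indicator)
    finally show ?thesis by simp
  qed
  have eq1: "moving_average u t = 1" if "t \<in> {a..b}" for t
  proof -
    have "moving_average u t = (LINT r|lborel. indicator {0..1::real} r)"
      unfolding moving_average_def using that u(3)
      by (intro Bochner_Integration.integral_cong refl) (auto split: split_indicator)
    then show ?thesis using one by simp
  qed
  have "norm (fourier_line (moving_average u) \<xi>) \<le> (2 * C) / (1 + \<bar>\<xi>\<bar>) ^ Suc n" for \<xi>
  proof -
    have "norm (fourier_line (moving_average u) \<xi>) \<le> (2 / (1 + \<bar>\<xi>\<bar>)) * (C / (1 + \<bar>\<xi>\<bar>) ^ n)"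
      unfolding fourier_line_moving_average[OF u(1)] norm_mult
      by (intro mult_mono fourier_line_interval_bound C) auto
    then show ?thesis by simp
  qed
  then show ?case
    using moving_average_integrable[OF u(1)] moving_average_continuous[OF u(1)] le1 eq1
    by (intro exI[of _ "moving_average u"]) blast
qed

lemma borel_measurable_fourier [measurable]:
  assumes [measurable]: "u \<in> borel_measurable borel"
  shows "fourier u \<in> borel_measurable borel"
  unfolding fourier_def[abs_def] by measurable

lemma one_plus_norm_le_prod: "1 + norm (x :: real ^ 'd) \<le> (\<Prod>i\<in>UNIV. 1 + \<bar>x $ i\<bar>)"
proof -
  have "1 + (\<Sum>i\<in>I. \<bar>x $ i\<bar>) \<le> (\<Prod>i\<in>I. 1 + \<bar>x $ i\<bar>)" if "finite I" for I
    using that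
  proof (induction I rule: finite_induct)
    case (insert i I)
    have "1 \<le> (\<Prod>i\<in>I. 1 + \<bar>x $ i\<bar>)" by (intro prod_ge_1) simp
    then have "\<bar>x $ i\<bar> * 1 \<le> \<bar>x $ i\<bar> * (\<Prod>i\<in>I. 1 + \<bar>x $ i\<bar>)" by (intro mult_left_mono) auto
    then show ?case using insert by (simp add: algebra_simps)
  qed simp
  from this[of UNIV] show ?thesis using norm_le_l1_cart[of x] by simp
qed

text \<open>The product of \<open>d\<close> copies of a one-dimensional cutoff. The weight \<open>(1 + |\<xi>|) powr s\<close> is at most the
product of the weights of the coordinates, so the decay in each coordinate suffices.\<close>

lemma cutoff_vec:
  fixes s :: real
  assumes s: "s \<ge> 0"
  shows "\<exists>u :: real ^ 'd \<Rightarrow> complex. continuous_on UNIV u \<and> integrable lborel u \<and> (\<forall>x. norm (u x) \<le> 1) \<and>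
    (\<forall>x\<in>unit_cube. u x = 1) \<and> integrable lborel (\<lambda>\<xi>. (1 + norm \<xi>) powr s *\<^sub>R fourier u \<xi>)"
proof -
  \<comment> \<open>Two orders more than the weight consumes leave an integrable decay of order two.\<close>
  define n where "n = nat \<lceil>s\<rceil> + 2"
  have n: "s + 2 \<le> real n" unfolding n_def by linarith
  have n0: "n > 0" by (simp add: n_def)
  from cutoff_line[of 0 1 n] obtain v C where v: "integrable lborel v" "\<forall>t. norm (v t) \<le> 1" "\<forall>t\<in>{0..1}. v t = 1"
      "n > 0 \<longrightarrow> continuous_on UNIV v" and C': "\<forall>\<xi>. norm (fourier_line v \<xi>) \<le> C / (1 + \<bar>\<xi>\<bar>) ^ n"
    by (elim exE conjE)
  note C = C'[rule_format]
  define u where "u x = (\<Prod>i\<in>UNIV. v (x $ i))" for x :: "real ^ 'd"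
  have cont: "continuous_on UNIV u"
    unfolding u_def by (intro continuous_on_prod continuous_on_compose2[OF v(4)[rule_format, OF n0]] continuous_intros) auto
  have four: "fourier u \<xi> = (\<Prod>i\<in>UNIV. fourier_line v (\<xi> $ i))" for \<xi>
  proof -
    have "u x * exp (- \<i> * complex_of_real (2 * pi * (\<xi> \<bullet> x))) =
      (\<Prod>i\<in>UNIV. v (x $ i) * exp (- \<i> * complex_of_real (2 * pi * (\<xi> $ i * x $ i))))" for x
      unfolding u_def prod.distrib exp_sum[OF finite, symmetric]
      by (simp add: inner_vec_def sum_distrib_left sum_negf)
    then have "fourier u \<xi> = (LINT x|lborel. (\<Prod>i\<in>UNIV. v (x $ i) * exp (- \<i> * complex_of_real (2 * pi * (\<xi> $ i * x $ i)))))"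
      unfolding fourier_def by simp
    also have "\<dots> = (\<Prod>i\<in>UNIV. fourier_line v (\<xi> $ i))"
      unfolding fourier_line_def
      by (rule integral_lborel_prod_vec) (rule integrable_times_bounded[OF v(1)], simp_all)
    finally show ?thesis .
  qed
  have bound: "norm ((1 + norm \<xi>) powr s *\<^sub>R fourier u \<xi>) \<le> norm (\<Prod>i\<in>UNIV. C * inverse (1 + (\<xi> $ i)\<^sup>2))"
    for \<xi> :: "real ^ 'd"
  proof -
    have "(1 + norm \<xi>) powr s \<le> (\<Prod>i\<in>UNIV. 1 + \<bar>\<xi> $ i\<bar>) powr s"
      using one_plus_norm_le_prod s by (intro powr_mono2) auto
    also have "\<dots> = (\<Prod>i\<in>UNIV. (1 + \<bar>\<xi> $ i\<bar>) powr s)"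
      by (rule prod_powr_distrib)
    finally have 1: "(1 + norm \<xi>) powr s \<le> (\<Prod>i\<in>UNIV. (1 + \<bar>\<xi> $ i\<bar>) powr s)" .
    have one: "(1 + \<bar>t\<bar>) powr s * norm (fourier_line v t) \<le> C * inverse (1 + t\<^sup>2)" for t
    proof -
      have C0: "0 \<le> C" using order_trans[OF norm_ge_zero C[of 0]] by simp
      have "(1 + \<bar>t\<bar>) powr s * (1 + t\<^sup>2) \<le> (1 + \<bar>t\<bar>) powr s * (1 + \<bar>t\<bar>) powr 2"
        by (intro mult_left_mono) (simp_all add: power2_sum)
      also have "\<dots> \<le> (1 + \<bar>t\<bar>) powr real n"
        using n by (simp add: powr_add[symmetric] powr_mono del: powr_numeral)
      also have "\<dots> = (1 + \<bar>t\<bar>) ^ n" by (simp add: powr_realpow add_pos_nonneg)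
      finally have *: "(1 + \<bar>t\<bar>) powr s * (1 + t\<^sup>2) \<le> (1 + \<bar>t\<bar>) ^ n" .
      have "(1 + \<bar>t\<bar>) powr s * norm (fourier_line v t) \<le> (1 + \<bar>t\<bar>) powr s * (C / (1 + \<bar>t\<bar>) ^ n)"
        by (intro mult_left_mono C) simp
      also have "\<dots> \<le> C * inverse (1 + t\<^sup>2)"
      proof -
        have "(1 + \<bar>t\<bar>) powr s / (1 + \<bar>t\<bar>) ^ n \<le> inverse (1 + t\<^sup>2)"
          using * by (simp add: divide_simps add_pos_nonneg)
        from mult_left_mono[OF this C0] show ?thesis by (simp add: mult_ac)
      qed
      finally show ?thesis .
    qed
    have "norm ((1 + norm \<xi>) powr s *\<^sub>R fourier u \<xi>) = (1 + norm \<xi>) powr s * (\<Prod>i\<in>UNIV. norm (fourier_line v (\<xi> $ i)))"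
      by (simp add: four prod_norm)
    also have "\<dots> \<le> (\<Prod>i\<in>UNIV. (1 + \<bar>\<xi> $ i\<bar>) powr s) * (\<Prod>i\<in>UNIV. norm (fourier_line v (\<xi> $ i)))"
      using 1 by (intro mult_right_mono prod_nonneg) auto
    also have "\<dots> = (\<Prod>i\<in>UNIV. (1 + \<bar>\<xi> $ i\<bar>) powr s * norm (fourier_line v (\<xi> $ i)))"
      by (simp add: prod.distrib)
    also have "\<dots> \<le> (\<Prod>i\<in>UNIV. C * inverse (1 + (\<xi> $ i)\<^sup>2))"
      using one by (intro prod_mono conjI) auto
    finally show ?thesis by simp
  qed
  have um[measurable]: "u \<in> borel_measurable borel" using cont by (rule borel_measurable_continuous_onI)
  have "integrable lborel (\<lambda>\<xi>. (1 + norm \<xi>) powr s *\<^sub>R fourier u \<xi>)"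
  proof (rule Bochner_Integration.integrable_bound)
    show "integrable lborel (\<lambda>\<xi>::real ^ 'd. \<Prod>i\<in>UNIV. C * inverse (1 + (\<xi> $ i)\<^sup>2))"
      by (intro integrable_lborel_prod_vec integrable_mult_right integrable_inverse_one_plus_square)
  qed (use bound in auto)
  moreover have "integrable lborel u" unfolding u_def[abs_def] by (intro integrable_lborel_prod_vec v(1))
  moreover have "norm (u x) \<le> 1" for x
    unfolding u_def prod_norm[symmetric] using v(2) by (intro prod_le_1) auto
  moreover have "u x = 1" if "x \<in> unit_cube" for x
    unfolding u_def using that v(3) by (intro prod.neutral) (auto simp: unit_cube_def less_imp_le)
  ultimately show ?thesis using cont by blast
qed

section \<open>Barron representations have spectral extensions\<close>

text \<open>For an integrable function the integral transform is the distributional one; this is Fubini's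
theorem for \<open>u x \<psi> y exp (- 2 \<pi> i y \<bullet> x)\<close>.\<close>

lemma has_fourier_transform_integrable:
  fixes u :: "real ^ 'd \<Rightarrow> complex"
  assumes u: "integrable lborel u"
  shows "has_fourier_transform u (fourier u)"
  unfolding has_fourier_transform_def distribution_fourier_def regular_distribution_def
proof
  fix \<psi> :: "real ^ 'd \<Rightarrow> complex" assume \<psi>: "\<psi> \<in> schwartz_space"
  have [measurable]: "u \<in> borel_measurable borel" "\<psi> \<in> borel_measurable borel"
    using borel_measurable_integrable[OF u] borel_measurable_integrable[OF schwartz_integrable[OF \<psi>]] by simp_all
  let ?e = "\<lambda>x y. exp (- \<i> * complex_of_real (2 * pi * (y \<bullet> x)))"
  have int: "integrable (lborel \<Otimes>\<^sub>M lborel) (\<lambda>(x, y). u x * \<psi> y * ?e x y)"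
    by (rule lborel_pair.integrable_pair_bounded[OF u schwartz_integrable[OF \<psi>]]) (simp_all add: norm_mult)
  have "(LINT x|lborel. u x * fourier \<psi> x) = (LINT x|lborel. LINT y|lborel. u x * \<psi> y * ?e x y)"
    unfolding fourier_def by (simp add: inner_commute mult.assoc)
  also have "\<dots> = (LINT y|lborel. LINT x|lborel. u x * \<psi> y * ?e x y)"
    using int by (rule lborel_pair.Fubini_integral[symmetric])
  also have "\<dots> = (LINT y|lborel. fourier u y * \<psi> y)"
    unfolding fourier_def integral_mult_left_zero[symmetric]
    by (intro Bochner_Integration.integral_cong refl) (simp add: mult_ac)
  finally show "(LINT x|lborel. u x * fourier \<psi> x) = (LINT y|lborel. fourier u y * \<psi> y)" .
qed

text \<open>Functions qualifying as spectral extensions by means of their integral transform, with a bound on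
the weighted norm. Stated with the nonnegative integral, the condition is stable under sums and
follows from Tonelli's theorem.\<close>

definition fourier_bound :: "real \<Rightarrow> (real ^ 'd \<Rightarrow> complex) \<Rightarrow> real \<Rightarrow> bool" where
  "fourier_bound s u K \<longleftrightarrow> continuous_on UNIV u \<and> bounded (range u) \<and> integrable lborel u \<and>
     (\<integral>\<^sup>+\<xi>. ennreal ((1 + norm \<xi>) powr s * norm (fourier u \<xi>)) \<partial>lborel) \<le> ennreal K"

lemma fourier_integrand_integrable:
  fixes u :: "real ^ 'd \<Rightarrow> complex"
  assumes "integrable lborel u"
  shows "integrable lborel (\<lambda>x. u x * exp (- \<i> * complex_of_real (2 * pi * (\<xi> \<bullet> x))))"
  by (rule integrable_times_bounded[OF assms]) auto

lemma fourier_bound_add: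
  assumes u: "fourier_bound s u K" and v: "fourier_bound s v L" and "0 \<le> K" "0 \<le> L"
  shows "fourier_bound s (\<lambda>x. u x + v x) (K + L)"
proof -
  have iu: "integrable lborel u" and iv: "integrable lborel v" using u v by (auto simp: fourier_bound_def)
  note [measurable] = borel_measurable_integrable[OF iu] borel_measurable_integrable[OF iv]
  have f: "fourier (\<lambda>x. u x + v x) \<xi> = fourier u \<xi> + fourier v \<xi>" for \<xi>
    unfolding fourier_def using fourier_integrand_integrable[OF iu] fourier_integrand_integrable[OF iv]
    by (simp add: distrib_right)
  have "(\<integral>\<^sup>+\<xi>. ennreal ((1 + norm \<xi>) powr s * norm (fourier (\<lambda>x. u x + v x) \<xi>)) \<partial>lborel) \<le>
     (\<integral>\<^sup>+\<xi>. ennreal ((1 + norm \<xi>) powr s * norm (fourier u \<xi>)) + ennreal ((1 + norm \<xi>) powr s * norm (fourier v \<xi>)) \<partial>lborel)"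
    unfolding f
    by (intro nn_integral_mono) (auto simp: distrib_left[symmetric] norm_triangle_ineq intro!: ennreal_leI mult_left_mono simp flip: ennreal_plus)
  also have "\<dots> \<le> ennreal K + ennreal L"
    using u v by (subst nn_integral_add) (auto simp: fourier_bound_def intro!: add_mono)
  finally show ?thesis
    using u v assms(3,4) unfolding fourier_bound_def
    by (auto intro!: continuous_intros bounded_plus_comp simp: ennreal_plus)
qed

lemma fourier_bound_cmult:
  assumes u: "fourier_bound s u K" and c: "norm c = 1"
  shows "fourier_bound s (\<lambda>x. c * u x) K"
proof -
  have "fourier (\<lambda>x. c * u x) \<xi> = c * fourier u \<xi>" for \<xi>
    unfolding fourier_def by (simp add: mult.assoc)
  then have "norm (fourier (\<lambda>x. c * u x) \<xi>) = norm (fourier u \<xi>)" for \<xi> using c by (simp add: norm_mult)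
  moreover have "bounded (range (\<lambda>x. c * u x))"
    using u c by (auto simp: fourier_bound_def bounded_iff norm_mult)
  ultimately show ?thesis using u unfolding fourier_bound_def
    by (auto intro!: continuous_intros)
qed

lemma one_plus_norm_add_powr_le:
  assumes "s \<ge> 0"
  shows "(1 + norm (x + y)) powr s \<le> (1 + norm x) powr s * (1 + norm y) powr s"
proof -
  have "1 + norm (x + y) \<le> (1 + norm x) * (1 + norm y)"
  proof -
    have "(1 + norm x) * (1 + norm y) = 1 + norm x + norm y + norm x * norm y" by (simp add: algebra_simps)
    moreover have "0 \<le> norm x * norm y" by simp
    ultimately show ?thesis using norm_triangle_ineq[of x y] by linarith
  qed
  then have "(1 + norm (x + y)) powr s \<le> ((1 + norm x) * (1 + norm y)) powr s"
    using assms by (intro powr_mono2) auto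
  then show ?thesis by (simp add: powr_mult)
qed

lemma nn_integral_lborel_shift:
  fixes f :: "'a::euclidean_space \<Rightarrow> ennreal"
  assumes [measurable]: "f \<in> borel_measurable borel"
  shows "(\<integral>\<^sup>+x. f (c + x) \<partial>lborel) = (\<integral>\<^sup>+x. f x \<partial>lborel)"
  by (subst (2) lborel_distr_plus[symmetric, of c]) (simp add: nn_integral_distr)

lemma norm_integral_le_nn_integral:
  fixes f :: "'a \<Rightarrow> 'b::{banach,second_countable_topology}"
  shows "ennreal (norm (integral\<^sup>L M f)) \<le> (\<integral>\<^sup>+x. ennreal (norm (f x)) \<partial>M)"
  by (cases "integrable M f") (simp_all add: integral_norm_bound_ennreal not_integrable_integral_eq)

text \<open>Multiplying \<open>u\<close> by the character of frequency \<open>w\<close> shifts its transform by \<open>w\<close>, so the transform of the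
product is a superposition of shifts of \<open>fourier u\<close>. By submultiplicativity of the weight, the
shift by \<open>w\<close> multiplies the weighted norm by at most \<open>(1 + |w|) powr s\<close>.\<close>

lemma fourier_bound_exponential_superposition:
  fixes u :: "real ^ 'd \<Rightarrow> complex" and m :: "((real ^ 'd) \<times> real) measure"
  assumes sets_m[measurable_cong]: "sets m = sets borel" and fin: "emeasure m UNIV < \<infinity>" and s: "s \<ge> 0"
    and u: "continuous_on UNIV u" "integrable lborel u" "\<And>x. norm (u x) \<le> 1"
    and I: "(\<integral>\<^sup>+\<xi>. ennreal ((1 + norm \<xi>) powr s * norm (fourier u \<xi>)) \<partial>lborel) \<le> ennreal I"
    and K: "(\<integral>\<^sup>+(w, b). ennreal ((1 + norm w) powr s) \<partial>m) \<le> ennreal K" and "0 \<le> I" "0 \<le> K"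
  shows "fourier_bound s (\<lambda>x. u x * (LINT (w, b)|m. exp (\<i> * complex_of_real (2 * pi * (w \<bullet> x + b))))) (I * K)"
proof -
  have space_m: "space m = UNIV" using sets_eq_imp_space_eq[OF sets_m] by simp
  have [measurable]: "fst \<in> borel_measurable m" "snd \<in> borel_measurable m"
    unfolding measurable_cong_sets[OF sets_m refl]
    by (auto intro!: borel_measurable_continuous_onI continuous_intros)
  interpret m: finite_measure m by standard (use fin space_m in auto)
  interpret P: pair_sigma_finite lborel m ..
  let ?e = "\<lambda>x w b. exp (\<i> * complex_of_real (2 * pi * (w \<bullet> x + b)))"
  define F where "F x = (LINT (w, b)|m. ?e x w b)" for x
  have [measurable]: "u \<in> borel_measurable borel" using u(1) by (rule borel_measurable_continuous_onI)
  have Fle: "norm (F x) \<le> measure m UNIV" for x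
  proof -
    have "norm (F x) \<le> (LINT p|m. norm (case p of (w, b) \<Rightarrow> ?e x w b))"
      unfolding F_def by (rule integral_norm_bound)
    also have "\<dots> = (LINT p|m. 1)" by (intro Bochner_Integration.integral_cong refl) auto
    finally show ?thesis by (simp add: space_m)
  qed
  have Fcont: "continuous_on UNIV F"
  proof -
    have "(\<lambda>n. F (X n)) \<longlonglongrightarrow> F x" if X: "X \<longlonglongrightarrow> x" for X x
      unfolding F_def
    proof (rule integral_dominated_convergence[where w="\<lambda>_. 1"])
      show "AE p in m. (\<lambda>n. case p of (w, b) \<Rightarrow> ?e (X n) w b) \<longlonglongrightarrow> (case p of (w, b) \<Rightarrow> ?e x w b)"
        by (intro AE_I2) (auto intro!: tendsto_intros X split: prod.splits)
    qed (auto simp: case_prod_unfold)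
    then show ?thesis
      by (auto simp: continuous_on_eq_continuous_at continuous_at_sequentially o_def)
  qed
  have [measurable]: "F \<in> borel_measurable borel" using Fcont by (rule borel_measurable_continuous_onI)
  have uF: "integrable lborel (\<lambda>x. u x * F x)"
  proof (rule Bochner_Integration.integrable_bound)
    show "integrable lborel (\<lambda>x. measure m UNIV *\<^sub>R u x)" using u(2) by simp
    show "AE x in lborel. norm (u x * F x) \<le> norm (measure m UNIV *\<^sub>R u x)"
    proof (intro AE_I2)
      fix x
      show "norm (u x * F x) \<le> norm (measure m UNIV *\<^sub>R u x)"
        using mult_left_mono[OF Fle[of x] norm_ge_zero[of "u x"]] by (simp add: norm_mult mult.commute)
    qed
  qed measurable
  have fourier_uF: "fourier (\<lambda>x. u x * F x) \<xi> = (LINT (w, b)|m. exp (\<i> * complex_of_real (2 * pi * b)) * fourier u (\<xi> - w))" for \<xi>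
  proof -
    let ?k = "\<lambda>x. exp (- \<i> * complex_of_real (2 * pi * (\<xi> \<bullet> x)))"
    have int: "integrable (lborel \<Otimes>\<^sub>M m) (\<lambda>(x, (w, b)). u x * ?e x w b * ?k x)"
      by (rule P.integrable_pair_bounded[OF u(2), of "\<lambda>_. 1"]) (auto simp: norm_mult)
    have "fourier (\<lambda>x. u x * F x) \<xi> = (LINT x|lborel. LINT p|m. (case p of (w, b) \<Rightarrow> u x * ?e x w b * ?k x))"
      unfolding fourier_def F_def integral_mult_right_zero[symmetric] integral_mult_left_zero[symmetric]
      by (intro Bochner_Integration.integral_cong refl) (auto split: prod.splits)
    also have "\<dots> = (LINT p|m. LINT x|lborel. (case p of (w, b) \<Rightarrow> u x * ?e x w b * ?k x))"
      by (rule P.Fubini_integral[symmetric]) (use int in \<open>simp add: case_prod_unfold\<close>)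
    also have "\<dots> = (LINT p|m. (case p of (w, b) \<Rightarrow> exp (\<i> * complex_of_real (2 * pi * b)) * fourier u (\<xi> - w)))"
    proof (intro Bochner_Integration.integral_cong refl, clarify)
      fix w :: "real ^ 'd" and b :: real
      show "(LINT x|lborel. u x * ?e x w b * ?k x) = exp (\<i> * complex_of_real (2 * pi * b)) * fourier u (\<xi> - w)"
        unfolding fourier_def integral_mult_right_zero[symmetric]
        by (intro Bochner_Integration.integral_cong refl)
          (simp add: mult_exp_exp inner_diff_left algebra_simps)
    qed
    finally show ?thesis .
  qed
  let ?W = "\<lambda>\<xi>::real ^ 'd. (1 + norm \<xi>) powr s"
  have "(\<integral>\<^sup>+\<xi>. ennreal (?W \<xi> * norm (fourier (\<lambda>x. u x * F x) \<xi>)) \<partial>lborel) \<le>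
      (\<integral>\<^sup>+\<xi>. \<integral>\<^sup>+p. ennreal (?W \<xi> * norm (fourier u (\<xi> - fst p))) \<partial>m \<partial>lborel)"
  proof (rule nn_integral_mono)
    fix \<xi> :: "real ^ 'd"
    have "ennreal (norm (fourier (\<lambda>x. u x * F x) \<xi>)) \<le> (\<integral>\<^sup>+p. ennreal (norm (fourier u (\<xi> - fst p))) \<partial>m)"
      unfolding fourier_uF
      by (rule order_trans[OF norm_integral_le_nn_integral])
        (auto intro!: nn_integral_mono simp: norm_mult split: prod.splits)
    then have "ennreal (?W \<xi>) * ennreal (norm (fourier (\<lambda>x. u x * F x) \<xi>)) \<le>
        ennreal (?W \<xi>) * (\<integral>\<^sup>+p. ennreal (norm (fourier u (\<xi> - fst p))) \<partial>m)"
      by (rule mult_left_mono) simp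
    then show "ennreal (?W \<xi> * norm (fourier (\<lambda>x. u x * F x) \<xi>)) \<le> (\<integral>\<^sup>+p. ennreal (?W \<xi> * norm (fourier u (\<xi> - fst p))) \<partial>m)"
      by (simp add: ennreal_mult nn_integral_cmult)
  qed
  also have "\<dots> = (\<integral>\<^sup>+p. \<integral>\<^sup>+\<xi>. ennreal (?W \<xi> * norm (fourier u (\<xi> - fst p))) \<partial>lborel \<partial>m)"
    by (rule P.Fubini'[symmetric]) measurable
  also have "\<dots> \<le> (\<integral>\<^sup>+p. ennreal (?W (fst p)) * ennreal I \<partial>m)"
  proof (rule nn_integral_mono)
    fix p :: "(real ^ 'd) \<times> real"
    have "(\<integral>\<^sup>+\<xi>. ennreal (?W \<xi> * norm (fourier u (\<xi> - fst p))) \<partial>lborel) =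
        (\<integral>\<^sup>+\<xi>. ennreal (?W (fst p + \<xi>) * norm (fourier u \<xi>)) \<partial>lborel)"
      using nn_integral_lborel_shift[of "\<lambda>\<xi>. ennreal (?W \<xi> * norm (fourier u (\<xi> - fst p)))" "fst p"] by simp
    also have "\<dots> \<le> (\<integral>\<^sup>+\<xi>. ennreal (?W (fst p)) * ennreal (?W \<xi> * norm (fourier u \<xi>)) \<partial>lborel)"
      using one_plus_norm_add_powr_le[OF s, of "fst p"]
      by (intro nn_integral_mono) (auto simp: mult.assoc[symmetric] intro!: ennreal_leI mult_right_mono simp flip: ennreal_mult)
    also have "\<dots> = ennreal (?W (fst p)) * (\<integral>\<^sup>+\<xi>. ennreal (?W \<xi> * norm (fourier u \<xi>)) \<partial>lborel)"
      by (rule nn_integral_cmult) measurable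
    also have "\<dots> \<le> ennreal (?W (fst p)) * ennreal I" using I by (rule mult_left_mono) simp
    finally show "(\<integral>\<^sup>+\<xi>. ennreal (?W \<xi> * norm (fourier u (\<xi> - fst p))) \<partial>lborel) \<le> ennreal (?W (fst p)) * ennreal I" .
  qed
  also have "\<dots> = (\<integral>\<^sup>+p. ennreal (?W (fst p)) \<partial>m) * ennreal I"
    by (rule nn_integral_multc) measurable
  also have "\<dots> \<le> ennreal K * ennreal I" using K by (intro mult_right_mono) (simp_all add: case_prod_unfold)
  also have "\<dots> = ennreal (I * K)" using \<open>0 \<le> I\<close> \<open>0 \<le> K\<close> by (simp add: ennreal_mult mult.commute)
  finally have bnd: "(\<integral>\<^sup>+\<xi>. ennreal (?W \<xi> * norm (fourier (\<lambda>x. u x * F x) \<xi>)) \<partial>lborel) \<le> ennreal (I * K)" .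
  have "norm (u x * F x) \<le> measure m UNIV" for x
    unfolding norm_mult using mult_mono[OF u(3) Fle, of x x] by simp
  then have "bounded (range (\<lambda>x. u x * F x))" by (auto simp: bounded_iff)
  then show ?thesis
    using uF bnd u(1) Fcont unfolding fourier_bound_def F_def[symmetric]
    by (auto intro!: continuous_intros)
qed

text \<open>The extension is the cutoff times the integral over \<open>\<rho>\<close>, split into the four positive measures of the
Jordan decompositions. Each of them is dominated by the total variation, whence the factor 4. The
constant depends only on the cutoff, so it is chosen before \<open>f\<close> and \<open>\<rho>\<close>.\<close>

lemma barron_representation_extension:
  fixes s :: real
  assumes s: "s \<ge> 1"
  defines "\<phi> \<equiv> \<lambda>x. (1 + ReLU x) powr s" and "\<sigma> \<equiv> \<lambda>x::real. exp (\<i> * complex_of_real (2 * pi * x))"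
  shows "\<exists>I>0. \<forall>(f :: real ^ 'd \<Rightarrow> complex) \<rho>. barron_representation unit_cube \<sigma> \<phi> f \<rho> \<longrightarrow>
    (\<exists>u. (AE x in lebesgue_on unit_cube. f x = u x) \<and>
      fourier_bound s u (I * (LINT (w, b)|total_variation borel \<rho>. \<phi> (l1_norm w + \<bar>b\<bar>))))"
proof -
  obtain \<kappa> :: "real ^ 'd \<Rightarrow> complex" where \<kappa>: "continuous_on UNIV \<kappa>" "integrable lborel \<kappa>" "\<And>x. norm (\<kappa> x) \<le> 1"
    "\<And>x. x \<in> unit_cube \<Longrightarrow> \<kappa> x = 1" and int\<kappa>: "integrable lborel (\<lambda>\<xi>. (1 + norm \<xi>) powr s *\<^sub>R fourier \<kappa> \<xi>)"
    using cutoff_vec[of s] s by force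
  \<comment> \<open>The constant is \<open>4 * (J + 1)\<close>: one is added to \<open>J\<close> to have it positive without further argument.\<close>
  define J where "J = (LINT \<xi>|lborel. norm ((1 + norm \<xi>) powr s *\<^sub>R fourier \<kappa> \<xi>))"
  have J0: "J \<ge> 0" unfolding J_def by (intro Bochner_Integration.integral_nonneg) simp
  have J: "(\<integral>\<^sup>+\<xi>. ennreal ((1 + norm \<xi>) powr s * norm (fourier \<kappa> \<xi>)) \<partial>lborel) \<le> ennreal (J + 1)"
  proof -
    have "(\<integral>\<^sup>+\<xi>. ennreal ((1 + norm \<xi>) powr s * norm (fourier \<kappa> \<xi>)) \<partial>lborel) = ennreal J"
      unfolding J_def using nn_integral_eq_integral[OF integrable_norm[OF int\<kappa>]] by simp
    also have "\<dots> \<le> ennreal (J + 1)" by (intro ennreal_leI) simp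
    finally show ?thesis .
  qed
  show ?thesis
  proof (intro exI[of _ "4 * (J + 1)"] conjI allI impI)
    show "4 * (J + 1) > 0" using J0 by simp
    fix f :: "real ^ 'd \<Rightarrow> complex" and \<rho>
    assume rep: "barron_representation unit_cube \<sigma> \<phi> f \<rho>"
    let ?T = "total_variation borel \<rho>"
    define K where "K = (LINT (w, b)|?T. \<phi> (l1_norm w + \<bar>b\<bar>))"
    from rep have \<rho>: "complex_measure borel \<rho>" and fin: "emeasure ?T UNIV < \<infinity>"
      and f: "AE x in lebesgue_on unit_cube. f x = complex_integral borel \<rho> (\<lambda>(w, b). \<sigma> (w \<bullet> x + b))"
      and int\<phi>: "integrable ?T (\<lambda>(w, b). \<phi> (l1_norm w + \<bar>b\<bar>))"
      by (auto simp: barron_representation_def finite_complex_radon_measure_def)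
    have K0: "K \<ge> 0" unfolding K_def by (intro Bochner_Integration.integral_nonneg) (auto simp: \<phi>_def)
    have KT: "(\<integral>\<^sup>+(w, b). ennreal ((1 + norm w) powr s) \<partial>?T) \<le> ennreal K"
    proof -
      have "(\<integral>\<^sup>+(w, b). ennreal ((1 + norm w) powr s) \<partial>?T) \<le> (\<integral>\<^sup>+p. ennreal (case p of (w, b) \<Rightarrow> \<phi> (l1_norm w + \<bar>b\<bar>)) \<partial>?T)"
      proof (intro nn_integral_mono, clarify)
        fix w :: "real ^ 'd" and b :: real
        have "norm w \<le> l1_norm w" unfolding l1_norm_def by (rule norm_le_l1_cart)
        then have "1 + norm w \<le> 1 + ReLU (l1_norm w + \<bar>b\<bar>)" by (simp add: ReLU_def)
        then show "ennreal ((1 + norm w) powr s) \<le> ennreal (\<phi> (l1_norm w + \<bar>b\<bar>))"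
          unfolding \<phi>_def using s by (intro ennreal_leI powr_mono2) auto
      qed
      also have "\<dots> = ennreal K"
        unfolding K_def by (rule nn_integral_eq_integral[OF int\<phi>]) (auto simp: \<phi>_def)
      finally show ?thesis .
    qed
    define v where "v \<nu> x = \<kappa> x * (LINT (w, b)|positive_variation borel \<nu>. exp (\<i> * complex_of_real (2 * pi * (w \<bullet> x + b))))"
      for \<nu> :: "((real ^ 'd) \<times> real) set \<Rightarrow> real" and x
    have v: "fourier_bound s (v \<nu>) ((J + 1) * K)" if "\<And>B. \<nu> B \<le> cmod (\<rho> B)" for \<nu>
      unfolding v_def[abs_def]
    proof (rule fourier_bound_exponential_superposition)
      have le: "positive_variation borel \<nu> \<le> ?T"
        using positive_variation_le_total_variation[OF \<rho>, of \<nu>] that by blast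
      show "sets (positive_variation borel \<nu>) = sets borel" by simp
      show "emeasure (positive_variation borel \<nu>) UNIV < \<infinity>"
        using le_measureD3[OF le, of UNIV] fin by simp
      show "(\<integral>\<^sup>+(w, b). ennreal ((1 + norm w) powr s) \<partial>positive_variation borel \<nu>) \<le> ennreal K"
        by (rule order_trans[OF nn_integral_mono_measure[OF _ le] KT]) simp
    qed (use s \<kappa> J J0 K0 in auto)
    \<comment> \<open>The cutoff times the integral against \<open>\<rho>\<close>, with its differences spelled as sums with unimodular coefficients.\<close>
    define u where "u x = (v (\<lambda>A. Re (\<rho> A)) x + (-1) * v (\<lambda>A. - Re (\<rho> A)) x) +
       (\<i> * v (\<lambda>A. Im (\<rho> A)) x + (- \<i>) * v (\<lambda>A. - Im (\<rho> A)) x)" for x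
    have Re_Im: "Re z \<le> cmod z" "- Re z \<le> cmod z" "Im z \<le> cmod z" "- Im z \<le> cmod z" for z
      using abs_Re_le_cmod[of z] abs_Im_le_cmod[of z] by linarith+
    have "fourier_bound s u (((J + 1) * K + (J + 1) * K) + ((J + 1) * K + (J + 1) * K))"
      unfolding u_def[abs_def] using J0 K0
      by (intro fourier_bound_add fourier_bound_cmult v Re_Im) auto
    then have "fourier_bound s u (4 * (J + 1) * K)" by (simp add: algebra_simps)
    moreover have "AE x in lebesgue_on unit_cube. f x = u x"
      using f
    proof (rule AE_mp, intro AE_I2 impI)
      fix x assume "x \<in> space (lebesgue_on (unit_cube :: (real ^ 'd) set))"
        and fx: "f x = complex_integral borel \<rho> (\<lambda>(w, b). \<sigma> (w \<bullet> x + b))"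
      then have "\<kappa> x = 1" using \<kappa>(4) by simp
      then show "f x = u x"
        unfolding fx u_def v_def complex_integral_def signed_integral_def \<sigma>_def
        by (simp add: algebra_simps)
    qed
    ultimately show "\<exists>u. (AE x in lebesgue_on unit_cube. f x = u x) \<and>
        fourier_bound s u (4 * (J + 1) * (LINT (w, b)|?T. \<phi> (l1_norm w + \<bar>b\<bar>)))"
      unfolding K_def by blast
  qed
qed

lemma
  fixes u :: "real ^ 'd \<Rightarrow> complex"
  assumes u: "fourier_bound s u K"
  shows fourier_bound_integrable: "integrable lborel (\<lambda>\<xi>. (1 + norm \<xi>) powr s *\<^sub>R fourier u \<xi>)"
    and fourier_bound_integral_le:
      "K \<ge> 0 \<Longrightarrow> (LINT \<xi>|lborel. (1 + norm \<xi>) powr s * norm (fourier u \<xi>)) \<le> K"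
proof -
  have iu: "integrable lborel u" using u by (simp add: fourier_bound_def)
  have [measurable]: "u \<in> borel_measurable borel" using borel_measurable_integrable[OF iu] by simp
  have le: "(\<integral>\<^sup>+\<xi>. ennreal ((1 + norm \<xi>) powr s * norm (fourier u \<xi>)) \<partial>lborel) \<le> ennreal K"
    using u by (simp add: fourier_bound_def)
  show int: "integrable lborel (\<lambda>\<xi>. (1 + norm \<xi>) powr s *\<^sub>R fourier u \<xi>)"
    by (rule integrableI_bounded) (use le in \<open>auto intro: le_less_trans\<close>)
  have "ennreal (LINT \<xi>|lborel. norm ((1 + norm \<xi>) powr s *\<^sub>R fourier u \<xi>)) \<le> ennreal K"
    using le nn_integral_eq_integral[OF integrable_norm[OF int]] by simp
  then show "(LINT \<xi>|lborel. (1 + norm \<xi>) powr s * norm (fourier u \<xi>)) \<le> K" if "K \<ge> 0"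
    using that by (simp add: ennreal_le_iff)
qed

lemma fourier_bound_imp_spectral_extension:
  fixes u h :: "real ^ 'd \<Rightarrow> complex"
  assumes u: "fourier_bound s u K" and h: "\<And>x. x \<in> \<Omega> \<Longrightarrow> u x = h x"
  shows "spectral_extension s \<Omega> h u (fourier u)"
  using u h fourier_bound_integrable[OF u]
  by (auto simp: spectral_extension_def fourier_bound_def intro: has_fourier_transform_integrable)

section \<open>Spectral extensions have Barron representations\<close>

text \<open>The representing measure is \<open>g\<close> times Lebesgue measure, pushed forward along \<open>w \<mapsto> (w, 0)\<close>. Its total
variation is at most the push-forward of \<open>|g|\<close> times Lebesgue measure, which yields finiteness and the
bound; inner regularity holds for every finite Borel measure on a Euclidean space.\<close>

lemma spectral_extension_barron_representation:
  fixes h fe g :: "real ^ 'd \<Rightarrow> complex"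
  assumes s: "s \<ge> 1"
    and sp: "spectral_extension s \<Omega> h fe g" and \<Omega>: "\<Omega> \<in> sets lebesgue"
    and f: "AE x in lebesgue_on \<Omega>. f x = h x"
  defines "\<phi> \<equiv> \<lambda>x. (1 + ReLU x) powr s" and "\<sigma> \<equiv> \<lambda>x::real. exp (\<i> * complex_of_real (2 * pi * x))"
  shows "\<exists>\<rho>. barron_representation \<Omega> \<sigma> \<phi> f \<rho> \<and>
    (LINT (w, b)|total_variation borel \<rho>. \<phi> (l1_norm w + \<bar>b\<bar>)) \<le>
      real CARD('d) powr s * (LINT \<xi>|lborel. (1 + norm \<xi>) powr s * norm (g \<xi>))"
proof -
  let ?W = "\<lambda>\<xi>::real ^ 'd. (1 + norm \<xi>) powr s"
  define C where "C = real CARD('d) powr s"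
  define N where "N = (LINT \<xi>|lborel. ?W \<xi> * norm (g \<xi>))"
  have fe: "continuous_on UNIV fe" "bounded (range fe)" "\<And>x. x \<in> \<Omega> \<Longrightarrow> fe x = h x" "has_fourier_transform fe g"
    and Wg: "integrable lborel (\<lambda>\<xi>. ?W \<xi> *\<^sub>R g \<xi>)"
    using sp by (auto simp: spectral_extension_def)
  have W1: "1 \<le> ?W \<xi>" for \<xi> using s by (intro ge_one_powr_ge_zero) auto
  have W0: "?W \<xi> \<noteq> 0" for \<xi> using W1[of \<xi>] by (metis not_one_le_zero)
  \<comment> \<open>Integrability is only given for the weighted function, so the weight is divided out again.\<close>
  have gm[measurable]: "g \<in> borel_measurable borel"
  proof -
    have "(\<lambda>\<xi>. inverse (?W \<xi>) *\<^sub>R (?W \<xi> *\<^sub>R g \<xi>)) \<in> borel_measurable borel"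
      using borel_measurable_integrable[OF Wg] by measurable
    moreover have "(\<lambda>\<xi>. inverse (?W \<xi>) *\<^sub>R (?W \<xi> *\<^sub>R g \<xi>)) = g"
      by (rule ext) (simp only: scaleR_scaleR left_inverse[OF W0] scaleR_one)
    ultimately show ?thesis by simp
  qed
  have g: "integrable lborel g"
  proof (rule Bochner_Integration.integrable_bound[OF Wg])
    show "AE \<xi> in lborel. norm (g \<xi>) \<le> norm (?W \<xi> *\<^sub>R g \<xi>)"
      using W1 by (intro AE_I2) (simp add: mult_right_mono[where b=1 for b, simplified] mult_le_cancel_right1)
  qed simp
  define M where "M = distr lborel borel (\<lambda>w::real ^ 'd. (w, 0::real))"
  define G where "G p = g (fst p)" for p :: "(real ^ 'd) \<times> real"
  have emb[measurable]: "(\<lambda>w::real ^ 'd. (w, 0::real)) \<in> borel_measurable borel"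
    by (intro borel_measurable_continuous_onI continuous_intros)
  have fst_m[measurable]: "(fst :: (real ^ 'd) \<times> real \<Rightarrow> _) \<in> borel_measurable borel" "(snd :: (real ^ 'd) \<times> real \<Rightarrow> _) \<in> borel_measurable borel"
    by (auto intro!: borel_measurable_continuous_onI continuous_intros)
  have M: "sets borel = sets M" by (simp add: M_def)
  have Gm[measurable]: "G \<in> borel_measurable borel" unfolding G_def by measurable
  have G: "integrable M G"
    unfolding M_def by (subst integrable_distr_eq) (use g in \<open>simp_all add: G_def\<close>)
  define \<rho> where "\<rho> A = (LINT p:A|M. G p)" for A
  let ?T = "total_variation borel \<rho>"
  let ?D = "density M (\<lambda>p. ennreal (norm (G p)))"
  have T_le: "?T \<le> ?D" unfolding \<rho>_def[abs_def] by (rule total_variation_density_le[OF G M])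
  have T_nn: "(\<integral>\<^sup>+p. k p \<partial>?T) \<le> (\<integral>\<^sup>+w. ennreal (norm (g w)) * k (w, 0) \<partial>lborel)"
    if [measurable]: "k \<in> borel_measurable borel" for k
  proof -
    have "(\<integral>\<^sup>+p. k p \<partial>?T) \<le> (\<integral>\<^sup>+p. k p \<partial>?D)"
      by (rule nn_integral_mono_measure[OF _ T_le]) (simp add: M)
    also have "\<dots> = (\<integral>\<^sup>+p. ennreal (norm (G p)) * k p \<partial>M)"
      by (rule nn_integral_density) (simp_all add: M_def)
    also have "\<dots> = (\<integral>\<^sup>+w. ennreal (norm (g w)) * k (w, 0) \<partial>lborel)"
      unfolding M_def by (subst nn_integral_distr) (simp_all add: G_def)
    finally show ?thesis .
  qed
  have T_fin: "emeasure ?T UNIV < \<infinity>"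
  proof -
    have "emeasure ?T UNIV = (\<integral>\<^sup>+p. 1 \<partial>?T)" by simp
    also have "\<dots> \<le> (\<integral>\<^sup>+w. ennreal (norm (g w)) * 1 \<partial>lborel)" by (rule T_nn) simp
    also have "\<dots> < \<infinity>" using g by (simp add: integrable_iff_bounded)
    finally show ?thesis .
  qed
  have radon: "finite_complex_radon_measure \<rho>"
    unfolding finite_complex_radon_measure_def
  proof (intro conjI ballI)
    show "complex_measure borel \<rho>" unfolding \<rho>_def[abs_def] by (rule complex_measure_density[OF G M])
    show "emeasure ?T UNIV < \<infinity>" by (rule T_fin)
    show "emeasure ?T A = (SUP K\<in>{K. compact K \<and> K \<subseteq> A}. emeasure ?T K)" if "A \<in> sets borel" for A
      using inner_regular[of ?T A] T_fin that by (simp add: conj_commute)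
  qed
  have \<sigma>_meas[measurable]: "(\<lambda>(w, b). \<sigma> (w \<bullet> x + b)) \<in> borel_measurable borel" for x :: "real ^ 'd"
    unfolding \<sigma>_def case_prod_unfold by measurable
  have \<sigma>_norm: "norm (case p of (w, b) \<Rightarrow> \<sigma> (w \<bullet> x + b)) = 1" for x :: "real ^ 'd" and p
    by (auto simp: \<sigma>_def split: prod.splits)
  interpret T: finite_measure ?T by standard (use T_fin in auto)
  have int_\<sigma>: "integrable ?T (\<lambda>(w, b). \<sigma> (w \<bullet> x + b))" for x
    by (rule T.integrable_const_bound[of _ 1]) (use \<sigma>_norm \<sigma>_meas in auto)
  have repr: "complex_integral borel \<rho> (\<lambda>(w, b). \<sigma> (w \<bullet> x + b)) = fe x" for x
  proof -
    have "complex_integral borel \<rho> (\<lambda>(w, b). \<sigma> (w \<bullet> x + b)) = (LINT p|M. G p * (case p of (w, b) \<Rightarrow> \<sigma> (w \<bullet> x + b)))"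
      unfolding \<rho>_def[abs_def]
    proof (rule complex_integral_density[OF G M])
      show *: "(\<lambda>(w, b). \<sigma> (w \<bullet> x + b)) \<in> borel_measurable M" using \<sigma>_meas by (simp add: M_def)
      show "integrable M (\<lambda>p. G p * (case p of (w, b) \<Rightarrow> \<sigma> (w \<bullet> x + b)))"
        by (rule integrable_times_bounded[OF G *]) (simp add: \<sigma>_norm)
    qed
    also have "\<dots> = (LINT w|lborel. g w * \<sigma> (w \<bullet> x + 0))"
      unfolding M_def by (subst integral_distr) (use \<sigma>_meas in \<open>simp_all add: G_def\<close>)
    also have "\<dots> = fe x"
      using fourier_inversion[OF fe(1,2,4) g, of x] by (simp add: \<sigma>_def)
    finally show ?thesis .
  qed
  have \<phi>_le: "\<phi> (l1_norm w + \<bar>0\<bar>) \<le> C * ?W w" for w :: "real ^ 'd"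
  proof -
    have "l1_norm w \<le> (\<Sum>i\<in>(UNIV::'d set). norm w)"
      unfolding l1_norm_def by (intro sum_mono component_le_norm_cart)
    then have "l1_norm w \<le> real CARD('d) * norm w" by simp
    moreover have "l1_norm w \<ge> 0" unfolding l1_norm_def by (intro sum_nonneg) simp
    then have "ReLU (l1_norm w + \<bar>0\<bar>) = l1_norm w" by (simp add: ReLU_def)
    moreover have "1 \<le> real CARD('d)" by (simp add: Suc_leI)
    ultimately have "1 + ReLU (l1_norm w + \<bar>0\<bar>) \<le> real CARD('d) * (1 + norm w)"
      unfolding distrib_left by linarith
    then have "\<phi> (l1_norm w + \<bar>0\<bar>) \<le> (real CARD('d) * (1 + norm w)) powr s"
      unfolding \<phi>_def using s by (intro powr_mono2) (auto simp: ReLU_def)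
    then show ?thesis by (simp add: C_def powr_mult)
  qed
  have [measurable]: "(\<lambda>p :: (real ^ 'd) \<times> real. fst p $ i) \<in> borel_measurable borel" for i
    by (intro borel_measurable_continuous_onI continuous_intros)
  have \<phi>_meas[measurable]: "(\<lambda>(w::real ^ 'd, b). \<phi> (l1_norm w + \<bar>b\<bar>)) \<in> borel_measurable borel"
    unfolding \<phi>_def ReLU_def l1_norm_def case_prod_unfold by measurable
  have \<phi>_nn: "(\<integral>\<^sup>+p. ennreal (case p of (w, b) \<Rightarrow> \<phi> (l1_norm w + \<bar>b\<bar>)) \<partial>?T) \<le> ennreal (C * N)"
  proof -
    have "(\<integral>\<^sup>+p. ennreal (case p of (w, b) \<Rightarrow> \<phi> (l1_norm w + \<bar>b\<bar>)) \<partial>?T) \<le>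
        (\<integral>\<^sup>+w. ennreal (norm (g w)) * ennreal (case (w, 0) of (w, b) \<Rightarrow> \<phi> (l1_norm w + \<bar>b\<bar>)) \<partial>lborel)"
      by (rule T_nn) measurable
    also have "\<dots> \<le> (\<integral>\<^sup>+w. ennreal (C * norm (?W w *\<^sub>R g w)) \<partial>lborel)"
    proof (rule nn_integral_mono)
      fix w :: "real ^ 'd"
      have "norm (g w) * \<phi> (l1_norm w + \<bar>0\<bar>) \<le> norm (g w) * (C * ?W w)"
        by (intro mult_left_mono \<phi>_le) simp
      then show "ennreal (norm (g w)) * ennreal (case (w, 0) of (w, b) \<Rightarrow> \<phi> (l1_norm w + \<bar>b\<bar>)) \<le> ennreal (C * norm (?W w *\<^sub>R g w))"
        by (auto simp: mult_ac intro!: ennreal_leI simp flip: ennreal_mult')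
    qed
    also have "\<dots> = ennreal (C * N)"
      unfolding N_def using nn_integral_eq_integral[OF integrable_mult_right[OF integrable_norm[OF Wg], of C]]
      by (simp add: C_def)
    finally show ?thesis .
  qed
  have \<phi>0: "0 \<le> (case p of (w, b) \<Rightarrow> \<phi> (l1_norm w + \<bar>b\<bar>))" for p :: "(real ^ 'd) \<times> real"
    by (auto simp: \<phi>_def split: prod.splits)
  have int_\<phi>: "integrable ?T (\<lambda>(w, b). \<phi> (l1_norm w + \<bar>b\<bar>))"
  proof (rule integrableI_bounded)
    show "(\<integral>\<^sup>+p. ennreal (norm (case p of (w, b) \<Rightarrow> \<phi> (l1_norm w + \<bar>b\<bar>))) \<partial>?T) < \<infinity>"
      using \<phi>_nn \<phi>0 by (auto intro: le_less_trans)
  qed (use \<phi>_meas in simp)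
  have "ennreal (LINT (w, b)|?T. \<phi> (l1_norm w + \<bar>b\<bar>)) \<le> ennreal (C * N)"
    using \<phi>_nn nn_integral_eq_integral[OF int_\<phi>] \<phi>0 by simp
  moreover have "0 \<le> C * N" unfolding C_def N_def by (intro mult_nonneg_nonneg Bochner_Integration.integral_nonneg) auto
  ultimately have "(LINT (w, b)|?T. \<phi> (l1_norm w + \<bar>b\<bar>)) \<le> C * N" by (simp add: ennreal_le_iff)
  moreover have "AE x in lebesgue_on \<Omega>. integrable ?T (\<lambda>(w, b). \<sigma> (w \<bullet> x + b)) \<and>
      f x = complex_integral borel \<rho> (\<lambda>(w, b). \<sigma> (w \<bullet> x + b))"
    using f by (rule AE_mp) (intro AE_I2 impI, use int_\<sigma> repr fe(3) in auto)
  ultimately show ?thesis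
    using radon int_\<phi> unfolding barron_representation_def C_def N_def by blast
qed

section \<open>Equality of the spaces and equivalence of the norms\<close>

text \<open>The set where the functions differ is open, and nonempty open sets are not null. This turns the
almost everywhere representation of \<open>h\<close> into equality on all of \<open>\<Omega>\<close>, as an extension requires.\<close>

lemma continuous_AE_eq_imp_eq:
  fixes u h :: "'a::euclidean_space \<Rightarrow> 'b::real_normed_vector"
  assumes \<Omega>: "open \<Omega>" and u: "continuous_on \<Omega> u" and h: "continuous_on \<Omega> h"
    and ae: "AE x in lebesgue_on \<Omega>. u x = h x" and x: "x \<in> \<Omega>"
  shows "u x = h x"
proof (rule ccontr)
  assume "u x \<noteq> h x"
  let ?N = "\<Omega> \<inter> (\<lambda>x. u x - h x) -` (- {0})"
  have "open ?N" by (intro continuous_open_preimage continuous_intros u h \<Omega>)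
  moreover have "?N \<noteq> {}" using x \<open>u x \<noteq> h x\<close> by auto
  ultimately have not_negl: "\<not> negligible ?N" by (rule open_not_negligible)
  have "\<Omega> \<in> sets lebesgue" using \<Omega> by auto
  then have "AE x in lebesgue. x \<in> \<Omega> \<longrightarrow> u x = h x"
    using ae by (simp add: AE_restrict_space_iff)
  then obtain N where "{x \<in> space lebesgue. \<not> (x \<in> \<Omega> \<longrightarrow> u x = h x)} \<subseteq> N"
      "emeasure lebesgue N = 0" "N \<in> sets lebesgue"
    by (rule AE_E)
  moreover from this have "N \<in> null_sets lebesgue" by (intro null_setsI)
  ultimately have "negligible ?N" by (auto simp: negligible_iff_null_sets[symmetric] elim!: negligible_subset)
  with not_negl show False by simp
qed

lemma open_unit_cube: "open (unit_cube :: (real ^ 'd) set)"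
proof -
  have "(unit_cube :: (real ^ 'd) set) = (\<Inter>i. {x. 0 < x $ i} \<inter> {x. x $ i < 1})"
    by (auto simp: unit_cube_def)
  also have "open \<dots>"
    by (intro open_INT ballI open_Int open_Collect_less continuous_intros finite)
  finally show ?thesis .
qed

theorem proposition2p6:
  fixes s :: real
    and \<Omega> :: "(real ^ 'd) set"
    and \<phi> :: "real \<Rightarrow> real"
    and \<sigma> :: "real \<Rightarrow> complex"
  assumes "\<Omega> = unit_cube"
    and "s \<ge> 1"
    and "\<phi> = (\<lambda>x. (1 + ReLU x) powr s)"
    and "\<sigma> = (\<lambda>x. exp (\<i> * complex_of_real (2 * pi * x)))"
  shows "ae_class \<Omega> ` barron_space \<Omega> \<sigma> \<phi> = ae_class \<Omega> ` spectral_barron_space s \<Omega> \<and>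
    (\<exists>c C. 0 < c \<and> 0 < C \<and>
      (\<forall>f\<in>barron_space \<Omega> \<sigma> \<phi>. \<forall>h\<in>spectral_barron_space s \<Omega>.
         (AE x in lebesgue_on \<Omega>. f x = h x) \<longrightarrow>
           c * spectral_barron_norm s \<Omega> h \<le> barron_norm \<Omega> \<sigma> \<phi> f \<and>
           barron_norm \<Omega> \<sigma> \<phi> f \<le> C * spectral_barron_norm s \<Omega> h))"
proof -
  have "open \<Omega>" using open_unit_cube assms(1) by simp
  then have \<Omega>: "open \<Omega>" "\<Omega> \<in> sets lebesgue" by auto
  let ?B = "\<lambda>\<rho>. LINT (w, b)|total_variation borel \<rho>. \<phi> (l1_norm w + \<bar>b\<bar>)"
  let ?S = "\<lambda>g. LINT \<xi>|lborel. (1 + norm \<xi>) powr s * norm (g \<xi>)"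
  have B0: "0 \<le> ?B \<rho>" for \<rho> :: "((real ^ 'd) \<times> real) set \<Rightarrow> complex"
    by (intro Bochner_Integration.integral_nonneg) (auto simp: assms(3))
  have S0: "0 \<le> ?S g" for g :: "real ^ 'd \<Rightarrow> complex" by (intro Bochner_Integration.integral_nonneg) auto
  obtain I where I: "I > 0" and ext: "\<And>f \<rho>. barron_representation \<Omega> \<sigma> \<phi> f \<rho> \<Longrightarrow>
      \<exists>u. (AE x in lebesgue_on \<Omega>. f x = u x) \<and> fourier_bound s u (I * ?B \<rho>)"
    using barron_representation_extension[OF assms(2), where 'd='d] unfolding assms(1,3,4) by blast
  let ?C = "real CARD('d) powr s"
  have rep: "\<exists>\<rho>. barron_representation \<Omega> \<sigma> \<phi> f \<rho> \<and> ?B \<rho> \<le> ?C * ?S g"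
    if "spectral_extension s \<Omega> h fe g" "AE x in lebesgue_on \<Omega>. f x = h x" for f h fe g
    using spectral_extension_barron_representation[OF assms(2) that(1) \<Omega>(2) that(2)] unfolding assms(3,4) .
  have class_eq: "ae_class \<Omega> f = ae_class \<Omega> h" if "AE x in lebesgue_on \<Omega>. f x = h x" for f h
    unfolding ae_class_def using that by (auto elim!: AE_mp)
  have sub1: "ae_class \<Omega> f \<in> ae_class \<Omega> ` spectral_barron_space s \<Omega>" if f: "f \<in> barron_space \<Omega> \<sigma> \<phi>" for f
  proof -
    obtain \<rho> where "barron_representation \<Omega> \<sigma> \<phi> f \<rho>" using f by (auto simp: barron_space_def)
    from ext[OF this] obtain u where u: "AE x in lebesgue_on \<Omega>. f x = u x" "fourier_bound s u (I * ?B \<rho>)" by blast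
    have "spectral_extension s \<Omega> u u (fourier u)"
      by (rule fourier_bound_imp_spectral_extension[OF u(2)]) (rule refl)
    moreover have "continuous_on \<Omega> u" "bounded (u ` \<Omega>)"
      using u(2) by (auto simp: fourier_bound_def intro: continuous_on_subset bounded_subset)
    ultimately have "u \<in> spectral_barron_space s \<Omega>" by (auto simp: spectral_barron_space_def)
    then show ?thesis using class_eq[OF u(1)] by blast
  qed
  have sub2: "ae_class \<Omega> h \<in> ae_class \<Omega> ` barron_space \<Omega> \<sigma> \<phi>" if h: "h \<in> spectral_barron_space s \<Omega>" for h
  proof -
    obtain fe g where "spectral_extension s \<Omega> h fe g" "continuous_on \<Omega> h"
      using h by (auto simp: spectral_barron_space_def)
    moreover from this have "h \<in> borel_measurable (lebesgue_on \<Omega>)"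
      using \<Omega> by (intro continuous_imp_measurable_on_sets_lebesgue)
    ultimately have "h \<in> barron_space \<Omega> \<sigma> \<phi>"
      using rep[of h fe g h] by (auto simp: barron_space_def)
    then show ?thesis by blast
  qed
  have bounds: "(1 / I) * spectral_barron_norm s \<Omega> h \<le> barron_norm \<Omega> \<sigma> \<phi> f \<and>
       barron_norm \<Omega> \<sigma> \<phi> f \<le> ?C * spectral_barron_norm s \<Omega> h"
    if f: "f \<in> barron_space \<Omega> \<sigma> \<phi>" and h: "h \<in> spectral_barron_space s \<Omega>"
      and ae: "AE x in lebesgue_on \<Omega>. f x = h x" for f h
  proof
    have S_lower: "spectral_barron_norm s \<Omega> h \<le> ?S g" if "spectral_extension s \<Omega> h fe g" for fe g
      unfolding spectral_barron_norm_def using that S0 by (intro cInf_lower bdd_belowI[of _ 0]) auto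
    have B_lower: "barron_norm \<Omega> \<sigma> \<phi> f \<le> ?B \<rho>" if "barron_representation \<Omega> \<sigma> \<phi> f \<rho>" for \<rho>
      unfolding barron_norm_def using that B0 by (intro cInf_lower bdd_belowI[of _ 0]) auto
    show "(1 / I) * spectral_barron_norm s \<Omega> h \<le> barron_norm \<Omega> \<sigma> \<phi> f"
      unfolding barron_norm_def
    proof (rule cInf_greatest)
      show "{?B \<rho> |\<rho>. barron_representation \<Omega> \<sigma> \<phi> f \<rho>} \<noteq> {}" using f by (auto simp: barron_space_def)
      fix y assume "y \<in> {?B \<rho> |\<rho>. barron_representation \<Omega> \<sigma> \<phi> f \<rho>}"
      then obtain \<rho> where \<rho>: "y = ?B \<rho>" "barron_representation \<Omega> \<sigma> \<phi> f \<rho>" by blast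
      from ext[OF \<rho>(2)] obtain u where u: "AE x in lebesgue_on \<Omega>. f x = u x" "fourier_bound s u (I * ?B \<rho>)" by blast
      have "AE x in lebesgue_on \<Omega>. u x = h x" using u(1) ae by eventually_elim simp
      moreover have "continuous_on \<Omega> u" using u(2) by (auto simp: fourier_bound_def intro: continuous_on_subset)
      moreover have "continuous_on \<Omega> h" using h by (simp add: spectral_barron_space_def)
      ultimately have eq: "u x = h x" if "x \<in> \<Omega>" for x
        using continuous_AE_eq_imp_eq[OF \<Omega>(1)] that by blast
      have "spectral_barron_norm s \<Omega> h \<le> ?S (fourier u)"
        by (rule S_lower, rule fourier_bound_imp_spectral_extension[OF u(2) eq])
      also have "\<dots> \<le> I * ?B \<rho>"
        using I B0 by (intro fourier_bound_integral_le[OF u(2)]) simp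
      finally have "spectral_barron_norm s \<Omega> h \<le> I * ?B \<rho>" .
      then show "(1 / I) * spectral_barron_norm s \<Omega> h \<le> y" using I \<rho>(1) by (simp add: field_simps)
    qed
    have C: "?C > 0" by simp
    have "barron_norm \<Omega> \<sigma> \<phi> f / ?C \<le> spectral_barron_norm s \<Omega> h"
      unfolding spectral_barron_norm_def
    proof (rule cInf_greatest)
      show "{?S g |fe g. spectral_extension s \<Omega> h fe g} \<noteq> {}" using h by (auto simp: spectral_barron_space_def)
      fix y assume "y \<in> {?S g |fe g. spectral_extension s \<Omega> h fe g}"
      then obtain fe g where y: "y = ?S g" "spectral_extension s \<Omega> h fe g" by blast
      from rep[OF y(2) ae] obtain \<rho> where "barron_representation \<Omega> \<sigma> \<phi> f \<rho>" "?B \<rho> \<le> ?C * ?S g" by blast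
      then have "barron_norm \<Omega> \<sigma> \<phi> f \<le> ?C * y" using B_lower y(1) by fastforce
      then show "barron_norm \<Omega> \<sigma> \<phi> f / ?C \<le> y" using C by (simp add: field_simps)
    qed
    then show "barron_norm \<Omega> \<sigma> \<phi> f \<le> ?C * spectral_barron_norm s \<Omega> h" using C by (simp add: field_simps)
  qed
  show ?thesis
  proof (rule conjI)
    show "ae_class \<Omega> ` barron_space \<Omega> \<sigma> \<phi> = ae_class \<Omega> ` spectral_barron_space s \<Omega>"
      by (intro subset_antisym image_subsetI sub1 sub2)
  qed (rule exI[of _ "1 / I"], rule exI[of _ ?C], use I bounds in simp)
qed

end
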